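(* Let $F:\mathscr K\to L^2(\Omega)$ be uniformly continuous, let $X^0\in\mathscr K$, $V^0\in L^2(\Omega)$, $T>0$, and let $X\in\mathrm{Lip}_{\mathrm{loc}}([0,\infty);\mathscr K)$ be a Lagrangian solution, i.e. $X(0)=X^0$ and $$\dot X(t)+\partial I_{\mathscr K}(X(t))\ni U(t)\ \text{for a.e. }t\ge0,\qquad U(t)=V^0+\int_0^tF[X(s)]\,ds,$$ with velocity $V(t)$ equal to the right derivative of $X$. For $t\in[0,T]$ let $M(t,\cdot)$ be the right-continuous generalized inverse of $X(t)$, and $M^0$ that of $X^0$. Then $M$ is an entropy solution on $[0,T]$ of $$\partial_tM+\partial_x\mathcal U(t,M)=0,\qquad \mathcal U(t,m)=\int_0^mU(t,\omega)\,d\omega,$$ with initial datum $M^0$.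
   Context: $\Omega=(0,1)$ with Lebesgue measure; $\mathscr K=\{X\in L^2(\Omega):X\text{ nondecreasing}\}$ (right-continuous representatives), a closed convex cone. $I_{\mathscr K}$ is the indicator function ($0$ on $\mathscr K$, $+\infty$ off it), and $\partial I_{\mathscr K}(X)=N_X\mathscr K=\{W\in L^2(\Omega):\int_\Omega W(Y-X)\,dm\le0\ \forall Y\in\mathscr K\}$. $F$ uniformly continuous means $\|F[X_1]-F[X_2]\|_{L^2}\le\omega(\|X_1-X_2\|_{L^2})$ for a modulus of continuity $\omega$ (continuous, concave, $\omega(0)=0<\omega(r)$ for $r>0$). The right-continuous generalized inverse of $X\in\mathscr K$ is $M(x)=|\{m\in\Omega:X(m)\le x\}|$. An entropy solution with initial datum $M^0$ is $M\in L^\infty((0,T)\times\mathbb{R})\cap C([0,T];L^1_{\mathrm{loc}}(\mathbb{R}))$ with $\int_0^T\!\int_{\mathbb{R}}(|M-k|\varphi_t+\operatorname{sgn}(M-k)(\mathcal U(t,M)-\mathcal U(t,k))\varphi_x)\,dx\,dt+\int_{\mathbb{R}}|M^0-k|\varphi(0,x)\,dx\ge0$ for all $k$ in a dense subset of $\mathbb{R}$ and all nonnegative $\varphi\in C_c^\infty([0,T)\times\mathbb{R})$. *)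

theory Defs
  imports "HOL-Analysis.Analysis"
begin

definition Omega :: "real set" where
  "Omega = {0<..<1}"

definition L2 :: "(real \<Rightarrow> real) \<Rightarrow> bool" where
  "L2 X \<longleftrightarrow> (\<lambda>m. indicator Omega m * X m) \<in> borel_measurable lebesgue
            \<and> set_integrable lebesgue Omega (\<lambda>m. (X m)\<^sup>2)"

definition L2inner :: "(real \<Rightarrow> real) \<Rightarrow> (real \<Rightarrow> real) \<Rightarrow> real" where
  "L2inner X Y = (LINT m:Omega|lebesgue. X m * Y m)"

definition L2norm :: "(real \<Rightarrow> real) \<Rightarrow> real" where
  "L2norm X = sqrt (LINT m:Omega|lebesgue. (X m)\<^sup>2)"

text \<open>The cone of nondecreasing elements of L^2 (as equivalence classes:
  a.e. equal on Omega to a nondecreasing function).\<close>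
definition Kcone :: "(real \<Rightarrow> real) set" where
  "Kcone = {X. L2 X \<and> (\<exists>Y. mono_on Omega Y \<and> (AE m in lebesgue. m \<in> Omega \<longrightarrow> X m = Y m))}"

text \<open>Normal cone = subdifferential of the indicator function of Kcone.\<close>
definition normal_cone :: "(real \<Rightarrow> real) \<Rightarrow> (real \<Rightarrow> real) set" where
  "normal_cone X = {W. L2 W \<and> (\<forall>Y\<in>Kcone. L2inner W (\<lambda>m. Y m - X m) \<le> 0)}"

definition modulus_of_continuity :: "(real \<Rightarrow> real) \<Rightarrow> bool" where
  "modulus_of_continuity w \<longleftrightarrow> continuous_on {0..} w \<and> concave_on {0..} w
     \<and> w 0 = 0 \<and> (\<forall>r>0. w r > 0)"

definition unif_cont_K :: "((real \<Rightarrow> real) \<Rightarrow> (real \<Rightarrow> real)) \<Rightarrow> bool" where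
  "unif_cont_K F \<longleftrightarrow> (\<forall>X\<in>Kcone. L2 (F X)) \<and>
     (\<exists>w. modulus_of_continuity w \<and>
        (\<forall>X1\<in>Kcone. \<forall>X2\<in>Kcone.
           L2norm (\<lambda>m. F X1 m - F X2 m) \<le> w (L2norm (\<lambda>m. X1 m - X2 m))))"

definition lip_loc_K :: "(real \<Rightarrow> real \<Rightarrow> real) \<Rightarrow> bool" where
  "lip_loc_K X \<longleftrightarrow> (\<forall>t\<ge>0. X t \<in> Kcone) \<and>
     (\<forall>T>0. \<exists>L. \<forall>s\<in>{0..T}. \<forall>t\<in>{0..T}.
        L2norm (\<lambda>m. X t m - X s m) \<le> L * \<bar>t - s\<bar>)"

definition has_L2_derivative :: "(real \<Rightarrow> real \<Rightarrow> real) \<Rightarrow> (real \<Rightarrow> real) \<Rightarrow> real \<Rightarrow> bool" where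
  "has_L2_derivative X W t \<longleftrightarrow> L2 W \<and>
     ((\<lambda>h. L2norm (\<lambda>m. (X (t + h) m - X t m) / h - W m)) \<longlongrightarrow> 0) (at 0)"

text \<open>U(t) = V0 + \<integral>_0^t F[X(s)] ds as an L^2-valued (Bochner) integral, characterised
  by pairing with every element of L^2.\<close>
definition is_U :: "((real \<Rightarrow> real) \<Rightarrow> (real \<Rightarrow> real)) \<Rightarrow> (real \<Rightarrow> real \<Rightarrow> real)
     \<Rightarrow> (real \<Rightarrow> real) \<Rightarrow> (real \<Rightarrow> real \<Rightarrow> real) \<Rightarrow> bool" where
  "is_U F X V0 U \<longleftrightarrow> (\<forall>t\<ge>0. L2 (U t) \<and>
     (\<forall>\<phi>. L2 \<phi> \<longrightarrow> L2inner (U t) \<phi> = L2inner V0 \<phi> + (LBINT s=0..t. L2inner (F (X s)) \<phi>)))"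

definition lagrangian_solution :: "((real \<Rightarrow> real) \<Rightarrow> (real \<Rightarrow> real)) \<Rightarrow> (real \<Rightarrow> real)
     \<Rightarrow> (real \<Rightarrow> real) \<Rightarrow> (real \<Rightarrow> real \<Rightarrow> real) \<Rightarrow> (real \<Rightarrow> real \<Rightarrow> real) \<Rightarrow> bool" where
  "lagrangian_solution F X0 V0 X U \<longleftrightarrow>
     lip_loc_K X \<and> (AE m in lebesgue. m \<in> Omega \<longrightarrow> X 0 m = X0 m) \<and> is_U F X V0 U \<and>
     (AE t in lborel. t > 0 \<longrightarrow>
        (\<exists>W. has_L2_derivative X W t \<and> (\<lambda>m. U t m - W m) \<in> normal_cone (X t)))"

definition gen_inv :: "(real \<Rightarrow> real) \<Rightarrow> real \<Rightarrow> real" where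
  "gen_inv X x = measure lebesgue {m \<in> Omega. X m \<le> x}"

text \<open>Flux \<U>(t,m) = \<integral>_0^m U(t,\<omega>) d\<omega>, with U(t,.) extended by 0 outside Omega.\<close>
definition flux :: "(real \<Rightarrow> real \<Rightarrow> real) \<Rightarrow> real \<Rightarrow> real \<Rightarrow> real" where
  "flux U t m = (LINT w:(Omega \<inter> {..m})|lebesgue. U t w)"

fun Ck :: "nat \<Rightarrow> ('a::real_normed_vector \<Rightarrow> real) \<Rightarrow> bool" where
  "Ck 0 f = continuous_on UNIV f"
| "Ck (Suc n) f = (\<exists>f'. (\<forall>p. (f has_derivative f' p) (at p)) \<and> (\<forall>v. Ck n (\<lambda>p. f' p v)))"

definition smooth :: "('a::real_normed_vector \<Rightarrow> real) \<Rightarrow> bool" where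
  "smooth f \<longleftrightarrow> (\<forall>n. Ck n f)"

text \<open>Nonnegative elements of C_c^\<infinity>([0,T) \<times> R) (given by smooth functions on R^2
  whose support is a compact subset of (-\<infinity>,T) \<times> R).\<close>
definition test_fun :: "real \<Rightarrow> (real \<times> real \<Rightarrow> real) \<Rightarrow> bool" where
  "test_fun T \<phi> \<longleftrightarrow> smooth \<phi> \<and>
     (\<exists>C. compact C \<and> C \<subseteq> {..<T} \<times> UNIV \<and> (\<forall>p. p \<notin> C \<longrightarrow> \<phi> p = 0)) \<and>
     (\<forall>t x. 0 \<le> t \<longrightarrow> t < T \<longrightarrow> 0 \<le> \<phi> (t, x))"

definition dt :: "(real \<times> real \<Rightarrow> real) \<Rightarrow> real \<times> real \<Rightarrow> real" where
  "dt \<phi> p = deriv (\<lambda>s. \<phi> (s, snd p)) (fst p)"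

definition dx :: "(real \<times> real \<Rightarrow> real) \<Rightarrow> real \<times> real \<Rightarrow> real" where
  "dx \<phi> p = deriv (\<lambda>y. \<phi> (fst p, y)) (snd p)"

definition entropy_solution :: "real \<Rightarrow> (real \<Rightarrow> real \<Rightarrow> real) \<Rightarrow> (real \<Rightarrow> real \<Rightarrow> real)
     \<Rightarrow> (real \<Rightarrow> real) \<Rightarrow> bool" where
  "entropy_solution T M Fl M0 \<longleftrightarrow>
     \<comment> \<open>M \<in> L^\<infinity>((0,T) \<times> R)\<close>
     (\<lambda>p. indicator ({0<..<T} \<times> UNIV) p * M (fst p) (snd p)) \<in> borel_measurable lebesgue \<and>
     (\<exists>B. AE p in lebesgue. p \<in> {0<..<T} \<times> UNIV \<longrightarrow> \<bar>M (fst p) (snd p)\<bar> \<le> B) \<and>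
     \<comment> \<open>M \<in> C([0,T]; L^1_loc(R))\<close>
     (\<forall>t\<in>{0..T}. \<forall>a b. set_integrable lebesgue {a..b} (M t)) \<and>
     (\<forall>t\<in>{0..T}. \<forall>a b.
        ((\<lambda>s. LINT x:{a..b}|lebesgue. \<bar>M s x - M t x\<bar>) \<longlongrightarrow> 0) (at t within {0..T})) \<and>
     \<comment> \<open>entropy inequalities for all k in a dense subset of R\<close>
     (\<exists>D. closure D = UNIV \<and>
       (\<forall>k\<in>D. \<forall>\<phi>. test_fun T \<phi> \<longrightarrow>
          (LINT p:({0<..<T} \<times> UNIV)|lebesgue.
              \<bar>M (fst p) (snd p) - k\<bar> * dt \<phi> p
              + sgn (M (fst p) (snd p) - k) * (Fl (fst p) (M (fst p) (snd p)) - Fl (fst p) k) * dx \<phi> p)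
          + (LINT x|lebesgue. \<bar>M0 x - k\<bar> * \<phi> (0, x)) \<ge> 0))"

end

(* Since X is nondecreasing, {X \<le> x} coincides a.e. with {m \<le> M(x)}, so for every real k both
   |M - k| and sgn(M - k) (flux M - flux k) are, up to constants, integrals over m of sgn(m - k) and
   sgn(m - k) U(m) against the indicator of {X(m) \<le> x}.  Put psi(t,y) = \<integral>_y^\<infinity> phi(t,x) dx and
   G(t) = \<integral> sgn(m - k) psi(t,X(t,m)) dm + |k| \<integral> phi(t,x) dx.  By Fubini the x-integral in the entropy
   inequality is G'(t) - \<integral> sgn(m - k) phi(t,X) (U - X') dm, and the last integral is \<le> 0 because U - X' lies in
   the normal cone at X while X + e sgn(m - k) phi(t,X) is nondecreasing for small e > 0.  Integrating in
   time (G is Lipschitz) leaves -G(0), the negative of the initial term. *)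

theory Submission
  imports Defs
begin

section \<open>Square-integrable functions on the unit interval\<close>

text \<open>The data are weak in time. \<open>X t\<close> and \<open>U t\<close> are L2 functions
  for each separate \<open>t\<close>, without joint measurability in \<open>(t, m)\<close>;
  \<open>U\<close> is known only through its pairings with L2 functions, and the velocity only as an
  L2 limit at almost every \<open>t\<close>. Hence Fubini is applied in \<open>(x, m)\<close> at a
  frozen time, and in \<open>(t, x)\<close> only after \<open>M\<close> is shown to be jointly
  measurable, as a limit of Lipschitz functions, and the flux jointly continuous. The tail
  \<open>psi\<close> is chosen because its \<open>y\<close>-derivative is \<open>- phi\<close>:
  differentiating \<open>psi(t, X)\<close> then produces the very term \<open>- phi(t, X) X'\<close>
  that the cone inequality compares with \<open>- phi(t, X) U\<close>. Since \<open>X'\<close> is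
  only an L2 derivative, this chain rule is proved from a Taylor bound whose remainder is quadratic
  in the increment of \<open>X\<close>; by the Lipschitz bound on \<open>X\<close> its integral is
  of order \<open>h\<close> squared. No term of \<open>G\<close> remains at the final time because
  the support of a test function stays in \<open>t < T\<close>.\<close>

abbreviation mu :: "real measure" where
  "mu \<equiv> lebesgue_on Omega"

lemma Omega_lmeasurable: "Omega \<in> lmeasurable"
  by (simp add: Omega_def)

lemma Omega_sets [measurable, simp]: "Omega \<in> sets lebesgue"
  by (simp add: Omega_def)

interpretation mu: finite_measure mu
  by (rule finite_measure_lebesgue_on[OF Omega_lmeasurable])

interpretation lborel_mu: pair_sigma_finite lborel mu ..

lemma measure_mu_Omega [simp]: "measure mu Omega = 1"
  by (simp add: measure_restrict_space) (simp add: Omega_def)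

lemma set_integral_Omega: "(LINT m:Omega|lebesgue. f m) = (LINT m|mu. f m)"
  for f :: "real \<Rightarrow> real"
  by (simp add: integral_restrict_space set_lebesgue_integral_def)

lemma set_integrable_Omega: "set_integrable lebesgue Omega f \<longleftrightarrow> integrable mu f"
  for f :: "real \<Rightarrow> real"
  by (simp add: integrable_restrict_space set_integrable_def)

lemma AE_mu_iff: "(AE m in mu. P m) \<longleftrightarrow> (AE m in lebesgue. m \<in> Omega \<longrightarrow> P m)"
  by (simp add: AE_restrict_space_iff)

lemma L2_iff: "L2 X \<longleftrightarrow> X \<in> borel_measurable mu \<and> integrable mu (\<lambda>m. (X m)\<^sup>2)"
  by (simp add: L2_def set_integrable_Omega borel_measurable_restrict_space_iff)

lemma L2inner_eq: "L2inner X Y = (LINT m|mu. X m * Y m)"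
  by (simp add: L2inner_def set_integral_Omega)

lemma L2norm_eq: "L2norm X = sqrt (LINT m|mu. (X m)\<^sup>2)"
  by (simp add: L2norm_def set_integral_Omega)

lemma L2norm_nonneg [simp]: "0 \<le> L2norm X"
  by (simp add: L2norm_eq)

lemma L2norm_power2: "(L2norm X)\<^sup>2 = (LINT m|mu. (X m)\<^sup>2)"
  by (simp add: L2norm_eq)

lemma L2_measurable: "L2 X \<Longrightarrow> X \<in> borel_measurable mu"
  by (simp add: L2_iff)

lemma L2_mult_integrable:
  assumes "L2 X" "L2 Y" shows "integrable mu (\<lambda>m. X m * Y m)"
proof (rule Bochner_Integration.integrable_bound)
  show "integrable mu (\<lambda>m. (X m)\<^sup>2 + (Y m)\<^sup>2)"
    using assms by (simp add: L2_iff)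
  show "(\<lambda>m. X m * Y m) \<in> borel_measurable mu"
    using assms by (auto simp: L2_iff intro!: borel_measurable_times)
  have "\<bar>a * b\<bar> \<le> a\<^sup>2 + b\<^sup>2" for a b :: real
  proof -
    have "2 * \<bar>a * b\<bar> \<le> a\<^sup>2 + b\<^sup>2"
      using sum_squares_bound[of "\<bar>a\<bar>" "\<bar>b\<bar>"] by (simp add: abs_mult)
    moreover have "0 \<le> \<bar>a * b\<bar>" by simp
    ultimately show ?thesis by linarith
  qed
  then show "AE m in mu. norm (X m * Y m) \<le> norm ((X m)\<^sup>2 + (Y m)\<^sup>2)"
    by simp
qed

lemma L2_const: "L2 (\<lambda>_. c)"
  by (simp add: L2_iff)

lemma L2_bounded:
  assumes "X \<in> borel_measurable mu" "\<And>m. \<bar>X m\<bar> \<le> B" shows "L2 X"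
  unfolding L2_iff
proof
  show "integrable mu (\<lambda>m. (X m)\<^sup>2)"
    using assms(1) power_mono[OF assms(2) abs_ge_zero, of _ 2]
    by (intro mu.integrable_const_bound[where B = "B\<^sup>2"]) auto
qed fact

lemma L2_integrable: "L2 X \<Longrightarrow> integrable mu X"
  using L2_mult_integrable[of X "\<lambda>_. 1"] by (simp add: L2_const)

lemma L2_add:
  assumes "L2 X" "L2 Y" shows "L2 (\<lambda>m. X m + Y m)"
  using assms L2_mult_integrable[OF assms]
  by (auto simp: L2_iff power2_sum mult.assoc)

lemma L2_cmult: "L2 X \<Longrightarrow> L2 (\<lambda>m. c * X m)"
  by (auto simp: L2_iff power_mult_distrib)

lemma L2_divide: "L2 X \<Longrightarrow> L2 (\<lambda>m. X m / c)"
  using L2_cmult[of X "inverse c"] by (simp add: field_simps)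

lemma L2_diff:
  assumes "L2 X" "L2 Y" shows "L2 (\<lambda>m. X m - Y m)"
  using L2_add[OF assms(1) L2_cmult[OF assms(2), of "-1"]] by simp

lemma L2_mult_bounded:
  assumes "L2 X" "Y \<in> borel_measurable mu" "\<And>m. \<bar>Y m\<bar> \<le> B"
  shows "L2 (\<lambda>m. Y m * X m)"
  unfolding L2_iff
proof
  show "(\<lambda>m. Y m * X m) \<in> borel_measurable mu"
    using assms by (auto simp: L2_iff intro!: borel_measurable_times)
  show "integrable mu (\<lambda>m. (Y m * X m)\<^sup>2)"
  proof (rule Bochner_Integration.integrable_bound)
    show "integrable mu (\<lambda>m. B\<^sup>2 * (X m)\<^sup>2)"
      using assms by (simp add: L2_iff)
    show "(\<lambda>m. (Y m * X m)\<^sup>2) \<in> borel_measurable mu"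
      using assms by (auto simp: L2_iff intro!: borel_measurable_times borel_measurable_power)
    show "AE m in mu. norm ((Y m * X m)\<^sup>2) \<le> norm (B\<^sup>2 * (X m)\<^sup>2)"
      using power_mono[OF assms(3) abs_ge_zero, of _ 2]
      by (auto simp: power_mult_distrib intro!: mult_right_mono)
  qed
qed

lemma L2inner_le: 
  assumes "L2 X" "L2 Y" shows "\<bar>L2inner X Y\<bar> \<le> L2norm X * L2norm Y"
proof -
  define A where "A = (LINT m|mu. (X m)\<^sup>2)"
  define B where "B = (LINT m|mu. X m * Y m)"
  define C where "C = (LINT m|mu. (Y m)\<^sup>2)"
  have "A \<ge> 0" "C \<ge> 0" by (simp_all add: A_def C_def)
  have quad: "0 \<le> A - 2 * s * B + s\<^sup>2 * C" for s
  proof -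
    have "0 \<le> (LINT m|mu. (X m - s * Y m)\<^sup>2)" by simp
    also have "\<dots> = (LINT m|mu. (X m)\<^sup>2 - (2 * s) * (X m * Y m) + s\<^sup>2 * (Y m)\<^sup>2)"
      by (rule Bochner_Integration.integral_cong) (auto simp: power2_eq_square algebra_simps)
    also have "\<dots> = A - 2 * s * B + s\<^sup>2 * C"
      using assms L2_mult_integrable[OF assms] by (simp add: L2_iff A_def B_def C_def)
    finally show ?thesis .
  qed
  have "B\<^sup>2 \<le> A * C"
  proof (cases "C = 0")
    case True
    have "B = 0"
    proof (rule ccontr)
      assume "B \<noteq> 0"
      \<comment> \<open>With \<open>C = 0\<close> the quadratic is affine in \<open>s\<close>, and
        this \<open>s\<close> gives it the value -1.\<close>
      then show False using quad[of "(A + 1) / (2 * B)"] True by simp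
    qed
    then show ?thesis using True by simp
  next
    case False
    then have "C > 0" using \<open>C \<ge> 0\<close> by simp
    \<comment> \<open>\<open>B / C\<close> minimises the quadratic, so this is its sharpest
      instance.\<close>
    have "0 \<le> A - 2 * (B / C) * B + (B / C)\<^sup>2 * C" by (rule quad)
    also have "\<dots> = A - B\<^sup>2 / C" using \<open>C > 0\<close> by (simp add: power2_eq_square)
    finally show ?thesis using \<open>C > 0\<close> by (simp add: field_simps)
  qed
  then have "\<bar>B\<bar> \<le> sqrt (A * C)" by (simp add: real_le_rsqrt)
  then show ?thesis by (simp add: L2inner_eq L2norm_eq A_def B_def C_def real_sqrt_mult)
qed

lemma L2_abs: "L2 X \<Longrightarrow> L2 (\<lambda>m. \<bar>X m\<bar>)"
  by (auto simp: L2_iff intro!: borel_measurable_abs)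

lemma L2norm_abs: "L2norm (\<lambda>m. \<bar>X m\<bar>) = L2norm X"
  by (simp add: L2norm_eq)

lemma L2norm_const: "L2norm (\<lambda>_. c) = \<bar>c\<bar>"
  by (simp add: L2norm_eq measure_restrict_space)

lemma integral_abs_mult_le:
  assumes "L2 X" "L2 Y" shows "(LINT m|mu. \<bar>X m * Y m\<bar>) \<le> L2norm X * L2norm Y"
  using L2inner_le[OF L2_abs[OF assms(1)] L2_abs[OF assms(2)]]
  by (simp add: L2inner_eq abs_mult L2norm_abs)

text \<open>Cauchy-Schwarz against the constant 1, whose norm is 1 because \<open>Omega\<close> has
  unit measure.\<close>

lemma integral_abs_le_L2norm:
  assumes "L2 X" shows "(LINT m|mu. \<bar>X m\<bar>) \<le> L2norm X"
  using integral_abs_mult_le[OF assms L2_const[of 1]] by (simp add: L2norm_const)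

section \<open>The generalized inverse\<close>

lemma borel_measurable_mu: "f \<in> borel_measurable borel \<Longrightarrow> f \<in> borel_measurable mu"
  by (intro measurable_restrict_space1 measurable_completion) simp

lemma sgn_shift_measurable_mu [measurable]: "(\<lambda>m::real. sgn (m - k)) \<in> borel_measurable mu"
  by (rule borel_measurable_mu) measurable

lemma indicator_measurable_mu [measurable]:
  "(\<lambda>m::real. indicator {..x} m :: real) \<in> borel_measurable mu"
  by (rule borel_measurable_mu) measurable

lemma AE_mu_neq: "AE m in mu. m \<noteq> a"
  unfolding AE_mu_iff
  by (rule AE_completion) (use AE_lborel_singleton[of a] in auto)

lemma Kcone_L2: "X \<in> Kcone \<Longrightarrow> L2 X"
  by (simp add: Kcone_def)

lemma Kcone_measurable [measurable_dest]: "X \<in> Kcone \<Longrightarrow> X \<in> borel_measurable mu"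
  by (simp add: Kcone_def L2_iff)

lemma gen_inv_eq:
  assumes "X \<in> borel_measurable mu"
  shows "gen_inv X x = (LINT m|mu. indicator {..x} (X m))"
proof -
  have "{m \<in> space mu. X m \<le> x} \<in> sets mu"
    using assms by measurable
  then have "{m \<in> Omega. X m \<le> x} \<in> sets mu" by simp
  then have "(LINT m|mu. indicator {m \<in> Omega. X m \<le> x} m :: real) = measure mu {m \<in> Omega. X m \<le> x}"
    by (simp add: Int_absorb2)
  also have "\<dots> = gen_inv X x"
    by (simp add: gen_inv_def measure_restrict_space Int_absorb2)
  also have "(LINT m|mu. indicator {m \<in> Omega. X m \<le> x} m :: real) = (LINT m|mu. indicator {..x} (X m))"
    by (rule Bochner_Integration.integral_cong) (auto simp: indicator_def)
  finally show ?thesis by simp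
qed

lemma gen_inv_nonneg: "0 \<le> gen_inv X x"
  by (simp add: gen_inv_def)

lemma gen_inv_le_1: 
  assumes "X \<in> borel_measurable mu"
  shows "gen_inv X x \<le> 1"
proof -
  have "(LINT m|mu. indicator {..x} (X m)) \<le> (LINT m|mu. 1::real)"
    using assms by (intro integral_mono mu.integrable_const_bound[where B = 1])
      (auto simp: indicator_def)
  then show ?thesis by (simp add: gen_inv_eq assms)
qed

lemma gen_inv_cong_AE:
  assumes "X \<in> borel_measurable mu" "Y \<in> borel_measurable mu" "AE m in mu. X m = Y m"
  shows "gen_inv X x = gen_inv Y x"
  unfolding gen_inv_eq[OF assms(1)] gen_inv_eq[OF assms(2)]
  using assms by (intro integral_cong_AE) auto

text \<open>A sublevel set of a monotone representative is an initial interval of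
  \<open>Omega\<close>, up to its endpoint, and its length is the generalized inverse. Membership in
  \<open>Kcone\<close> gives monotonicity only almost everywhere, so the equivalence is stated for
  almost every \<open>m\<close>.\<close>

lemma gen_inv_sublevel:
  assumes X: "X \<in> Kcone"
  shows "AE m in mu. X m \<le> x \<longleftrightarrow> m \<le> gen_inv X x"
proof -
  obtain Y where Y: "mono_on Omega Y" and XY: "AE m in mu. X m = Y m"
    using X by (auto simp: Kcone_def AE_mu_iff)
  \<comment> \<open>Inserting 0 makes the supremum meaningful when the sublevel set is empty; then
    \<open>a = 0\<close>, the measure of that set.\<close>
  define a where "a = Sup (insert 0 {m \<in> Omega. Y m \<le> x})"
  have bdd: "bdd_above (insert 0 {m \<in> Omega. Y m \<le> x})"
    by (rule bdd_aboveI[where M = 1]) (auto simp: Omega_def)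
  have "0 \<le> a" unfolding a_def by (rule cSup_upper[OF _ bdd]) simp
  have "a \<le> 1" unfolding a_def by (rule cSup_least) (auto simp: Omega_def)
  have Y_iff: "Y m \<le> x \<longleftrightarrow> m \<le> a" if "m \<in> Omega" "m \<noteq> a" for m
  proof
    assume "Y m \<le> x" then show "m \<le> a"
      unfolding a_def using that by (intro cSup_upper[OF _ bdd]) simp
  next
    assume "m \<le> a"
    then have "m < a" using that by simp
    then obtain n where n: "n \<in> insert 0 {m \<in> Omega. Y m \<le> x}" "m < n"
      unfolding a_def using less_cSup_iff[OF _ bdd] by auto
    then have "n \<in> Omega" "Y n \<le> x" using that by (auto simp: Omega_def)
    then show "Y m \<le> x"
      using mono_onD[OF Y that(1) \<open>n \<in> Omega\<close>] n by simp
  qed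
  have AE: "AE m in mu. X m \<le> x \<longleftrightarrow> m \<le> a"
    using XY AE_mu_neq[of a] AE_space[of mu] by eventually_elim (auto simp: Y_iff)
  have "gen_inv X x = (LINT m|mu. indicator {..a} m)"
    unfolding gen_inv_eq[OF Kcone_measurable[OF X]]
  proof (rule integral_cong_AE)
    show "AE m in mu. indicator {..x} (X m) = (indicator {..a} m :: real)"
      using AE by eventually_elim (simp add: indicator_def)
  qed (use Kcone_measurable[OF X] in measurable)
  also have "\<dots> = gen_inv (\<lambda>m. m) a"
    by (subst gen_inv_eq) (auto intro!: borel_measurable_mu)
  \<comment> \<open>\<open>Omega\<close> is open, so the point 1 is missing from the interval when
    \<open>a = 1\<close>; it carries no mass.\<close>
  also have "\<dots> = measure lebesgue ({0<..a} - {1})"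
    unfolding gen_inv_def using \<open>a \<le> 1\<close>
    by (intro arg_cong[where f = "measure lebesgue"]) (auto simp: Omega_def)
  also have "\<dots> = a"
    using \<open>0 \<le> a\<close> by (subst measure_Diff_null_set) (auto)
  finally show ?thesis using AE by simp
qed

lemma gen_inv_id: "gen_inv (\<lambda>m. m) k = min 1 (max 0 k)"
proof -
  have "{m \<in> Omega. m \<le> k} = (if k < 1 then {0<..k} else {0<..<1})"
    by (auto simp: Omega_def)
  then show ?thesis by (cases "k \<ge> 0") (simp_all add: gen_inv_def del: Collect_empty_eq)
qed

section \<open>Entropy and entropy flux as integrals over the mass variable\<close>

lemma flux_eq: "flux U t m = (LINT w|mu. indicator {..m} w * U t w)"
proof -
  have "flux U t m = (LINT w|lebesgue. indicator Omega w *\<^sub>R (indicator {..m} w * U t w))"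
    unfolding flux_def set_lebesgue_integral_def
    by (rule Bochner_Integration.integral_cong) (auto simp: indicator_def)
  also have "\<dots> = (LINT w|mu. indicator {..m} w * U t w)"
    by (simp add: integral_restrict_space)
  finally show ?thesis .
qed

text \<open>On \<open>{..M}\<close> the sign is constantly -1 if \<open>M \<le> k\<close>; otherwise
  it changes at \<open>k\<close>, which subtracts twice the integral up to \<open>k\<close>. The
  point \<open>m = k\<close>, where the sign is 0, is null. Arbitrary real \<open>k\<close> are
  covered.\<close>

lemma integral_sgn_truncated:
  assumes U: "integrable mu U"
  shows "(LINT m|mu. sgn (m - k) * indicator {..M} m * U m) + (LINT m|mu. indicator {..k} m * U m)
    = sgn (M - k) * ((LINT m|mu. indicator {..M} m * U m) - (LINT m|mu. indicator {..k} m * U m))"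
proof (cases "M \<le> k")
  case True
  have [measurable]: "U \<in> borel_measurable mu" using U by simp
  have "(LINT m|mu. sgn (m - k) * indicator {..M} m * U m) = (LINT m|mu. - (indicator {..M} m * U m))"
  proof (rule integral_cong_AE)
    show "AE m in mu. sgn (m - k) * indicator {..M} m * U m = - (indicator {..M} m * U m)"
      using AE_mu_neq[of k] by eventually_elim (use True in \<open>auto simp: indicator_def sgn_if\<close>)
  qed measurable
  then show ?thesis using True by (cases "M = k") auto
next
  case False
  have [measurable]: "U \<in> borel_measurable mu" using U by simp
  have int: "integrable mu (\<lambda>m. indicator {..a} m * U m)" for a
  proof (rule Bochner_Integration.integrable_bound[OF U])
    show "AE m in mu. norm (indicator {..a} m * U m) \<le> norm (U m)"
      by (auto simp: indicator_def)
  qed measurable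
  have "(LINT m|mu. sgn (m - k) * indicator {..M} m * U m)
    = (LINT m|mu. indicator {..M} m * U m - 2 * (indicator {..k} m * U m))"
  proof (rule integral_cong_AE)
    show "AE m in mu. sgn (m - k) * indicator {..M} m * U m
        = indicator {..M} m * U m - 2 * (indicator {..k} m * U m)"
      using AE_mu_neq[of k] by eventually_elim (use False in \<open>auto simp: indicator_def sgn_if\<close>)
  qed measurable
  then show ?thesis using False int by simp
qed

lemma integral_sgn_sublevel:
  assumes X: "X \<in> Kcone" and U: "U \<in> borel_measurable mu"
  shows "(LINT m|mu. sgn (m - k) * U m * indicator {..x} (X m)) =
    (LINT m|mu. sgn (m - k) * indicator {..gen_inv X x} m * U m)"
proof (rule integral_cong_AE)
  show "AE m in mu. sgn (m - k) * U m * indicator {..x} (X m) =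
    sgn (m - k) * indicator {..gen_inv X x} m * U m"
    using gen_inv_sublevel[OF X] by eventually_elim (auto simp: indicator_def)
qed (use U Kcone_measurable[OF X] in measurable)

text \<open>The point is that the correction \<open>flux U t k\<close> does not depend on
  \<open>x\<close>: integrated against an \<open>x\<close>-derivative of compact support it
  contributes nothing.\<close>

lemma flux_entropy_eq:
  assumes X: "X \<in> Kcone" and U: "L2 (U t)"
  shows "sgn (gen_inv X x - k) * (flux U t (gen_inv X x) - flux U t k)
    = (LINT m|mu. sgn (m - k) * U t m * indicator {..x} (X m)) + flux U t k"
  using integral_sgn_truncated[OF L2_integrable[OF U], of k "gen_inv X x"]
  by (simp add: integral_sgn_sublevel[OF X L2_measurable[OF U]] flux_eq)

text \<open>The case \<open>U = 1\<close> of \<open>integral_sgn_truncated\<close> yields the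
  truncation of \<open>k\<close> to the unit interval instead of \<open>k\<close>. As the values of
  \<open>gen_inv\<close> lie in that interval, comparing the positions of \<open>k\<close> below,
  inside and above it turns the correction into \<open>\<bar>k\<bar>\<close>.\<close>

lemma abs_entropy_eq:
  assumes X: "X \<in> Kcone"
  shows "\<bar>gen_inv X x - k\<bar> = (LINT m|mu. sgn (m - k) * indicator {..x} (X m)) + \<bar>k\<bar>"
proof -
  have id: "(LINT m|mu. indicator {..a} m) = min 1 (max 0 a)" for a
    using gen_inv_eq[of "\<lambda>m. m" a] by (simp add: gen_inv_id borel_measurable_mu)
  have "(LINT m|mu. sgn (m - k) * indicator {..gen_inv X x} m) + min 1 (max 0 k)
      = sgn (gen_inv X x - k) * (min 1 (max 0 (gen_inv X x)) - min 1 (max 0 k))"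
    using integral_sgn_truncated[of "\<lambda>_. 1" k "gen_inv X x", unfolded mult_1_right id] by simp
  moreover have "(LINT m|mu. sgn (m - k) * indicator {..x} (X m))
      = (LINT m|mu. sgn (m - k) * indicator {..gen_inv X x} m)"
    using integral_sgn_sublevel[OF X, of "\<lambda>_. 1" k x] by simp
  ultimately show ?thesis
    using gen_inv_nonneg[of X x] gen_inv_le_1[OF Kcone_measurable[OF X], of x]
    by (auto simp: sgn_if min_def max_def split: if_splits)
qed

section \<open>Test functions and their tail integrals\<close>

text \<open>\<open>Ck\<close> gives continuity of the derivative only in each fixed direction. Two
  directions span the plane, each partial derivative is bounded on \<open>C\<close> by compactness
  and zero elsewhere, and the two bounds add up to one for the operator norm.\<close>

lemma Ck1_compact_support_lipschitz:
  fixes g :: "real \<times> real \<Rightarrow> real"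
  assumes "Ck (Suc 0) g" "compact C" "\<And>p. p \<notin> C \<Longrightarrow> g p = 0"
  shows "\<exists>L\<ge>0. \<forall>t x s y. \<bar>g (t, x) - g (s, y)\<bar> \<le> L * (\<bar>t - s\<bar> + \<bar>x - y\<bar>)"
proof -
  obtain g' where g': "\<And>p. (g has_derivative g' p) (at p)"
    and cont: "\<And>v. continuous_on UNIV (\<lambda>p. g' p v)"
    using assms(1) by auto
  \<comment> \<open>The complement of \<open>C\<close> is open and \<open>g\<close> vanishes there,
    so uniqueness of the derivative applies.\<close>
  have zero: "g' p v = 0" if "p \<notin> C" for p v
  proof -
    have "((\<lambda>_. 0) has_derivative g' p) (at p)"
    proof (rule has_derivative_transform_within_open[OF g'])
      show "open (- C)" using assms(2) by (simp add: compact_imp_closed open_Compl)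
    qed (use that assms(3) in auto)
    then have "g' p = (\<lambda>_. 0)"
      by (rule has_derivative_unique) (rule has_derivative_const)
    then show ?thesis by simp
  qed
  have bdd: "\<exists>K\<ge>0. \<forall>p. \<bar>g' p v\<bar> \<le> K" for v
  proof -
    have "compact ((\<lambda>p. g' p v) ` C)"
      using continuous_on_subset[OF cont] assms(2) by (intro compact_continuous_image) auto
    then obtain K where K: "\<And>p. p \<in> C \<Longrightarrow> \<bar>g' p v\<bar> \<le> K"
      by (meson bounded_real compact_imp_bounded imageI)
    have "\<bar>g' p v\<bar> \<le> \<bar>K\<bar>" for p
      using K[of p] zero[of p v] by (cases "p \<in> C") auto
    then show ?thesis by (intro exI[of _ "\<bar>K\<bar>"]) auto
  qed
  obtain K1 where K1: "K1 \<ge> 0" "\<And>p. \<bar>g' p (1, 0)\<bar> \<le> K1" using bdd by blast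
  obtain K2 where K2: "K2 \<ge> 0" "\<And>p. \<bar>g' p (0, 1)\<bar> \<le> K2" using bdd by blast
  have on: "onorm (g' p) \<le> K1 + K2" for p
  proof (rule onorm_le)
    fix v :: "real \<times> real"
    obtain a b where v: "v = (a, b)" by (cases v)
    interpret g': bounded_linear "g' p" using g' by (rule has_derivative_bounded_linear)
    have "v = a *\<^sub>R (1, 0) + b *\<^sub>R (0, 1)" by (simp add: v)
    then have "g' p v = a * g' p (1, 0) + b * g' p (0, 1)"
      by (metis g'.add g'.scaleR real_scaleR_def)
    then have "\<bar>g' p v\<bar> \<le> \<bar>a\<bar> * \<bar>g' p (1, 0)\<bar> + \<bar>b\<bar> * \<bar>g' p (0, 1)\<bar>"
      by (simp add: abs_mult[symmetric] abs_triangle_ineq)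
    also have "\<dots> \<le> norm v * K1 + norm v * K2"
      using K1 K2 norm_fst_le[of a b] norm_snd_le[of b a]
      by (intro add_mono mult_mono) (auto simp: v)
    finally show "norm (g' p v) \<le> (K1 + K2) * norm v" by (simp add: algebra_simps)
  qed
  have "\<bar>g (t, x) - g (s, y)\<bar> \<le> (K1 + K2) * (\<bar>t - s\<bar> + \<bar>x - y\<bar>)" for t x s y
  proof -
    have "norm (g (t, x) - g (s, y)) \<le> (K1 + K2) * norm ((t, x) - (s, y))"
      by (rule differentiable_bound[OF convex_UNIV]) (use g' on in auto)
    also have "\<dots> \<le> (K1 + K2) * (\<bar>t - s\<bar> + \<bar>x - y\<bar>)"
      using norm_Pair_le[of "t - s" "x - y"] K1(1) K2(1) by (intro mult_left_mono) auto
    finally show ?thesis by simp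
  qed
  then show ?thesis using K1(1) K2(1) by (intro exI[of _ "K1 + K2"]) auto
qed

text \<open>The Lipschitz bounds on \<open>\<phi>\<close> and \<open>\<phi>t\<close> give quadratic
  Taylor remainders in \<open>x\<close> and \<open>t\<close>. For \<open>\<phi>x\<close> continuity
  suffices, as it enters through the fundamental theorem of calculus and through its maximum on a
  compact box. Only the support in \<open>x\<close> is recorded; the final time is treated
  separately.\<close>

locale lipschitz_test_fun =
  fixes \<phi> \<phi>t \<phi>x :: "real \<Rightarrow> real \<Rightarrow> real" and R L :: real
  assumes R_pos: "R > 0" and L_nonneg: "L \<ge> 0"
    and support: "\<bar>x\<bar> \<ge> R \<Longrightarrow> \<phi> t x = 0" "\<bar>x\<bar> \<ge> R \<Longrightarrow> \<phi>t t x = 0" "\<bar>x\<bar> \<ge> R \<Longrightarrow> \<phi>x t x = 0"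
    and lip: "\<bar>\<phi> t x - \<phi> s y\<bar> \<le> L * (\<bar>t - s\<bar> + \<bar>x - y\<bar>)"
    and lip_t: "\<bar>\<phi>t t x - \<phi>t s y\<bar> \<le> L * (\<bar>t - s\<bar> + \<bar>x - y\<bar>)"
    and deriv_t: "((\<lambda>s. \<phi> s x) has_real_derivative \<phi>t t x) (at t)"
    and deriv_x: "(\<phi> t has_real_derivative \<phi>x t x) (at x)"
    and cont_x: "continuous_on UNIV (\<lambda>p. \<phi>x (fst p) (snd p))"

lemma test_fun_lipschitz_test_fun:
  assumes "test_fun T \<phi>"
  obtains R L where "lipschitz_test_fun (\<lambda>t x. \<phi> (t, x)) (\<lambda>t x. dt \<phi> (t, x)) (\<lambda>t x. dx \<phi> (t, x)) R L"
proof -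
  have Ck: "Ck n \<phi>" for n using assms by (simp add: test_fun_def smooth_def)
  obtain C where C: "compact C" "\<And>p. p \<notin> C \<Longrightarrow> \<phi> p = 0"
    using assms by (auto simp: test_fun_def)
  \<comment> \<open>Two orders of differentiability are extracted so that the partial derivatives
    are again of class \<open>Ck 1\<close>, hence Lipschitz.\<close>
  obtain f' where f': "\<And>p. (\<phi> has_derivative f' p) (at p)" and Ck1: "\<And>v. Ck (Suc 0) (\<lambda>p. f' p v)"
    using Ck[of "Suc (Suc 0)"] unfolding Ck.simps(2)[of "Suc 0"] by blast
  have line_t: "((\<lambda>s. \<phi> (s, x)) has_real_derivative f' (t, x) (1, 0)) (at t)" for t x
  proof -
    have "((\<lambda>s. (s, x)) has_derivative (\<lambda>h. (h, 0))) (at t)"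
      by (auto intro!: derivative_eq_intros)
    then have "((\<lambda>s. \<phi> (s, x)) has_derivative (\<lambda>h. f' (t, x) (h, 0))) (at t)"
      by (rule has_derivative_compose) (rule f')
    moreover have "(\<lambda>h. f' (t, x) (h, 0)) = (*) (f' (t, x) (1, 0))"
    proof
      fix h
      interpret f': bounded_linear "f' (t, x)" using f' by (rule has_derivative_bounded_linear)
      show "f' (t, x) (h, 0) = f' (t, x) (1, 0) * h"
        using f'.scaleR[of h "(1, 0)"] by simp
    qed
    ultimately show ?thesis by (simp add: has_field_derivative_def)
  qed
  have line_x: "((\<lambda>y. \<phi> (t, y)) has_real_derivative f' (t, x) (0, 1)) (at x)" for t x
  proof -
    have "((\<lambda>y. (t, y)) has_derivative (\<lambda>h. (0, h))) (at x)"
      by (auto intro!: derivative_eq_intros)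
    then have "((\<lambda>y. \<phi> (t, y)) has_derivative (\<lambda>h. f' (t, x) (0, h))) (at x)"
      by (rule has_derivative_compose) (rule f')
    moreover have "(\<lambda>h. f' (t, x) (0, h)) = (*) (f' (t, x) (0, 1))"
    proof
      fix h
      interpret f': bounded_linear "f' (t, x)" using f' by (rule has_derivative_bounded_linear)
      show "f' (t, x) (0, h) = f' (t, x) (0, 1) * h"
        using f'.scaleR[of h "(0, 1)"] by simp
    qed
    ultimately show ?thesis by (simp add: has_field_derivative_def)
  qed
  have dt: "dt \<phi> p = f' p (1, 0)" and dx: "dx \<phi> p = f' p (0, 1)" for p
    using DERIV_imp_deriv[OF line_t, of "snd p" "fst p"] DERIV_imp_deriv[OF line_x, of "fst p" "snd p"]
    by (simp_all add: dt_def dx_def)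
  have zero: "f' p v = 0" if "p \<notin> C" for p v
  proof -
    have "((\<lambda>_. 0) has_derivative f' p) (at p)"
    proof (rule has_derivative_transform_within_open[OF f'])
      show "open (- C)" using C(1) by (simp add: compact_imp_closed open_Compl)
    qed (use that C(2) in auto)
    then have "f' p = (\<lambda>_. 0)"
      by (rule has_derivative_unique) (rule has_derivative_const)
    then show ?thesis by simp
  qed
  obtain L1 where L1: "L1 \<ge> 0" "\<And>t x s y. \<bar>\<phi> (t, x) - \<phi> (s, y)\<bar> \<le> L1 * (\<bar>t - s\<bar> + \<bar>x - y\<bar>)"
    using Ck1_compact_support_lipschitz[OF Ck C] by blast
  obtain L2 where L2: "L2 \<ge> 0" "\<And>t x s y. \<bar>f' (t, x) (1, 0) - f' (s, y) (1, 0)\<bar> \<le> L2 * (\<bar>t - s\<bar> + \<bar>x - y\<bar>)"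
    using Ck1_compact_support_lipschitz[OF Ck1 C(1) zero] by blast
  obtain R where R: "\<And>p. p \<in> C \<Longrightarrow> norm p \<le> R"
    using C(1) by (meson bounded_iff compact_imp_bounded)
  \<comment> \<open>The added 1 makes the comparison with \<open>R\<close> strict, and the absolute
    value guards against a negative bound, possible when \<open>C\<close> is empty.\<close>
  have notin: "(t, x) \<notin> C" if "\<bar>x\<bar> \<ge> \<bar>R\<bar> + 1" for t x
    using R[of "(t, x)"] norm_snd_le[of x t] that by auto
  have cont: "continuous_on UNIV (\<lambda>p. f' p (0, 1))"
  proof -
    obtain g' where "\<And>p. ((\<lambda>p. f' p (0, 1)) has_derivative g' p) (at p)"
      using Ck1[of "(0, 1)"] by auto
    then show ?thesis by (meson continuous_at_imp_continuous_on has_derivative_continuous)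
  qed
  show ?thesis
  proof
    show "lipschitz_test_fun (\<lambda>t x. \<phi> (t, x)) (\<lambda>t x. dt \<phi> (t, x)) (\<lambda>t x. dx \<phi> (t, x)) (\<bar>R\<bar> + 1) (L1 + L2)"
    proof
      fix t x s y :: real
      show "\<bar>\<phi> (t, x) - \<phi> (s, y)\<bar> \<le> (L1 + L2) * (\<bar>t - s\<bar> + \<bar>x - y\<bar>)"
        using L1(2)[of t x s y] mult_right_mono[of L1 "L1 + L2" "\<bar>t - s\<bar> + \<bar>x - y\<bar>"] L2(1) by linarith
      show "\<bar>dt \<phi> (t, x) - dt \<phi> (s, y)\<bar> \<le> (L1 + L2) * (\<bar>t - s\<bar> + \<bar>x - y\<bar>)"
        using L2(2)[of t x s y] mult_right_mono[of L2 "L1 + L2" "\<bar>t - s\<bar> + \<bar>x - y\<bar>"] L1(1)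
        unfolding dt by linarith
      show "\<phi> (t, x) = 0" "dt \<phi> (t, x) = 0" "dx \<phi> (t, x) = 0" if "\<bar>R\<bar> + 1 \<le> \<bar>x\<bar>"
        using C(2)[OF notin[OF that]] zero[OF notin[OF that]] by (simp_all add: dt dx)
      show "((\<lambda>s. \<phi> (s, x)) has_real_derivative dt \<phi> (t, x)) (at t)"
        unfolding dt by (rule line_t)
      show "((\<lambda>y. \<phi> (t, y)) has_real_derivative dx \<phi> (t, x)) (at x)"
        unfolding dx by (rule line_x)
      show "continuous_on UNIV (\<lambda>p. dx \<phi> (fst p, snd p))"
        unfolding dx using cont by simp
    qed (use L1(1) L2(1) in auto)
  qed
qed

text \<open>\<open>tail_int (\<phi> t) y\<close> is the \<open>psi(t, y)\<close> of the overview.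
  The closed half-line matches the right-continuous inverse: \<open>x \<in> {X m..}\<close> says the
  same as \<open>X m \<in> {..x}\<close>.\<close>

definition tail_int :: "(real \<Rightarrow> real) \<Rightarrow> real \<Rightarrow> real" where
  "tail_int f y = (LINT x|lborel. indicator {y..} x * f x)"

lemma integrable_compact_support:
  fixes f :: "real \<Rightarrow> real"
  assumes "continuous_on UNIV f" "\<And>x. \<bar>x\<bar> \<ge> R \<Longrightarrow> f x = 0"
  shows "integrable lborel f"
proof -
  have "set_integrable lborel {-R..R} f"
    by (intro borel_integrable_atLeastAtMost' continuous_on_subset[OF assms(1)]) auto
  moreover have "(\<lambda>x. indicator {-R..R} x *\<^sub>R f x) = f"
  proof
    show "indicator {-R..R} x *\<^sub>R f x = f x" for x
      using assms(2)[of x] by (cases "\<bar>x\<bar> \<ge> R") (auto simp: indicator_def)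
  qed
  ultimately show ?thesis by (simp add: set_integrable_def)
qed

lemma abs_integral_le:
  fixes f g :: "'a \<Rightarrow> real"
  assumes "integrable M f" "integrable M g" "\<And>x. x \<in> space M \<Longrightarrow> \<bar>f x\<bar> \<le> g x"
  shows "\<bar>LINT x|M. f x\<bar> \<le> (LINT x|M. g x)"
proof -
  have "\<bar>LINT x|M. f x\<bar> \<le> (LINT x|M. \<bar>f x\<bar>)" by (rule integral_abs_bound)
  also have "\<dots> \<le> (LINT x|M. g x)" using assms by (intro integral_mono) auto
  finally show ?thesis .
qed

text \<open>First-order remainders, new value minus old value minus \<open>h\<close> times the
  derivative, have this shape.\<close>

lemma integral_diff_diff_mult:
  fixes f g k :: "'a \<Rightarrow> real"
  assumes "integrable M f" "integrable M g" "integrable M k"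
  shows "integrable M (\<lambda>x. f x - g x - c * k x)"
    "(LINT x|M. f x - g x - c * k x) = (LINT x|M. f x) - (LINT x|M. g x) - c * (LINT x|M. k x)"
  using assms by simp_all

lemma integrable_tail:
  fixes f :: "real \<Rightarrow> real"
  assumes "integrable lborel f"
  shows "integrable lborel (\<lambda>x. indicator {y..} x * f x)"
  using integrable_mult_indicator[OF _ assms, of "{y..}"] by simp

lemma tail_int_linear:
  assumes "integrable lborel f" "integrable lborel g" "integrable lborel k"
  shows "tail_int (\<lambda>x. f x - g x - c * k x) y = tail_int f y - tail_int g y - c * tail_int k y"
proof -
  have eq: "indicator {y..} x * (f x - g x - c * k x)
      = indicator {y..} x * f x - indicator {y..} x * g x - c * (indicator {y..} x * k x)" for x
    by (simp add: algebra_simps)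
  show ?thesis
    unfolding tail_int_def eq by (intro integral_diff_diff_mult(2) integrable_tail assms)
qed

lemma integral_indicator_Icc:
  assumes "a \<le> b"
  shows "(LINT x|lborel. indicator {a..<b} x * c) = (b - a) * (c::real)"
    "integrable lborel (\<lambda>x. indicator {a..<b} x * (c::real))"
  using assms by (auto simp: integrable_mult_left_iff)

text \<open>The tails differ by the integral over \<open>{y..<z}\<close>. With \<open>c\<close> a
  nearby value of \<open>f\<close> the estimate is a Taylor remainder, with \<open>c = 0\<close> a
  Lipschitz bound.\<close>

lemma tail_int_diff:
  assumes f: "integrable lborel f" and "y \<le> z"
  and bound: "\<And>x. y \<le> x \<Longrightarrow> x < z \<Longrightarrow> \<bar>f x - c\<bar> \<le> e"
  shows "\<bar>tail_int f y - tail_int f z - (z - y) * c\<bar> \<le> (z - y) * e"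
proof -
  note ind = integral_indicator_Icc[OF \<open>y \<le> z\<close>]
  have eq: "tail_int f y - tail_int f z - (z - y) * c
      = (LINT x|lborel. indicator {y..} x * f x - indicator {z..} x * f x - indicator {y..<z} x * c)"
    by (simp only: Bochner_Integration.integral_diff[OF Bochner_Integration.integrable_diff ind(2)]
        Bochner_Integration.integral_diff integrable_tail[OF f] ind(1) tail_int_def)
  have "\<bar>tail_int f y - tail_int f z - (z - y) * c\<bar> \<le> (LINT x|lborel. indicator {y..<z} x * e)"
    unfolding eq
  proof (rule abs_integral_le)
    show "integrable lborel (\<lambda>x. indicator {y..} x * f x - indicator {z..} x * f x - indicator {y..<z} x * c)"
      using integrable_tail[OF f] ind by simp
    show "\<bar>indicator {y..} x * f x - indicator {z..} x * f x - indicator {y..<z} x * c\<bar> \<le> indicator {y..<z} x * e"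
      for x using bound[of x] \<open>y \<le> z\<close> by (auto simp: indicator_def)
  qed (rule ind)
  then show ?thesis by (simp only: ind)
qed

section \<open>Taylor and Lipschitz estimates for the tail integrals of a test function\<close>

context lipschitz_test_fun
begin

lemma cont: "continuous_on UNIV (\<lambda>p. \<phi> (fst p) (snd p))"
proof -
  have "(2 * L)-lipschitz_on UNIV (\<lambda>p. \<phi> (fst p) (snd p))"
  proof (rule lipschitz_onI)
    fix p q :: "real \<times> real"
    have "\<bar>\<phi> (fst p) (snd p) - \<phi> (fst q) (snd q)\<bar> \<le> L * (dist p q + dist p q)"
      using lip[of "fst p" "snd p" "fst q" "snd q"] dist_fst_le[of p q] dist_snd_le[of p q] L_nonneg
      by (smt (verit) mult_left_mono dist_real_def)
    then show "dist (\<phi> (fst p) (snd p)) (\<phi> (fst q) (snd q)) \<le> 2 * L * dist p q"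
      by (simp add: dist_real_def)
  qed (use L_nonneg in simp)
  then show ?thesis by (rule lipschitz_on_continuous_on)
qed

lemma cont_t: "continuous_on UNIV (\<lambda>p. \<phi>t (fst p) (snd p))"
proof -
  have "(2 * L)-lipschitz_on UNIV (\<lambda>p. \<phi>t (fst p) (snd p))"
  proof (rule lipschitz_onI)
    fix p q :: "real \<times> real"
    have "\<bar>\<phi>t (fst p) (snd p) - \<phi>t (fst q) (snd q)\<bar> \<le> L * (dist p q + dist p q)"
      using lip_t[of "fst p" "snd p" "fst q" "snd q"] dist_fst_le[of p q] dist_snd_le[of p q] L_nonneg
      by (smt (verit) mult_left_mono dist_real_def)
    then show "dist (\<phi>t (fst p) (snd p)) (\<phi>t (fst q) (snd q)) \<le> 2 * L * dist p q"
      by (simp add: dist_real_def)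
  qed (use L_nonneg in simp)
  then show ?thesis by (rule lipschitz_on_continuous_on)
qed

lemma cont_slices: "continuous_on UNIV (\<phi> t)" "continuous_on UNIV (\<phi>t t)" "continuous_on UNIV (\<phi>x t)"
proof -
  have c: "continuous_on UNIV (\<lambda>x::real. (t, x))" by (intro continuous_intros)
  show "continuous_on UNIV (\<phi> t)" "continuous_on UNIV (\<phi>t t)" "continuous_on UNIV (\<phi>x t)"
    using continuous_on_compose2[OF cont c] continuous_on_compose2[OF cont_t c] 
      continuous_on_compose2[OF cont_x c] by simp_all
qed

lemma integrable_slices: "integrable lborel (\<phi> t)" "integrable lborel (\<phi>t t)" "integrable lborel (\<phi>x t)"
  using integrable_compact_support[OF cont_slices(1) support(1)]
    integrable_compact_support[OF cont_slices(2) support(2)]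
    integrable_compact_support[OF cont_slices(3) support(3)] by blast+

text \<open>Comparison with the point \<open>x = R\<close>, where both functions vanish and which is
  within \<open>2 * R\<close> of the support.\<close>

lemma bound: "\<bar>\<phi> t x\<bar> \<le> 2 * L * R" "\<bar>\<phi>t t x\<bar> \<le> 2 * L * R"
proof -
  have *: "L * (\<bar>t - t\<bar> + \<bar>x - R\<bar>) \<le> 2 * L * R" if "\<bar>x\<bar> < R"
  proof -
    have "\<bar>x - R\<bar> \<le> 2 * R" using that by (simp add: abs_if split: if_splits)
    from mult_left_mono[OF this L_nonneg] show ?thesis by (simp add: mult_ac)
  qed
  show "\<bar>\<phi> t x\<bar> \<le> 2 * L * R"
    using lip[of t x t R] support(1)[of x t] support(1)[of R t] * L_nonneg R_pos
    by (cases "\<bar>x\<bar> < R") auto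
  show "\<bar>\<phi>t t x\<bar> \<le> 2 * L * R"
    using lip_t[of t x t R] support(2)[of x t] support(2)[of R t] * L_nonneg R_pos
    by (cases "\<bar>x\<bar> < R") auto
qed

lemma tail_eq_integral:
  assumes "y \<le> -R"
  shows "tail_int (\<phi> t) y = (LINT x|lborel. \<phi> t x)" "tail_int (\<phi>t t) y = (LINT x|lborel. \<phi>t t x)"
    "tail_int (\<phi>x t) y = (LINT x|lborel. \<phi>x t x)"
  unfolding tail_int_def using assms support
  by (auto intro!: Bochner_Integration.integral_cong simp: indicator_def)

lemma tail_phi_x: "tail_int (\<phi>x t) y = - \<phi> t y"
proof -
  \<comment> \<open>The upper limit \<open>max y R\<close> keeps the interval nonempty when
    \<open>y > R\<close>; in either case \<open>\<phi> t\<close> vanishes there.\<close>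
  have "tail_int (\<phi>x t) y = (LINT x|lborel. \<phi>x t x * indicator {y..max y R} x)"
    unfolding tail_int_def using support(3)
    by (auto intro!: Bochner_Integration.integral_cong simp: indicator_def max_def)
  also have "\<dots> = \<phi> t (max y R) - \<phi> t y"
    using cont_slices(3) deriv_x
    by (intro integral_FTC_Icc_real) (auto simp: continuous_on_eq_continuous_at)
  also have "\<phi> t (max y R) = 0" using support(1) R_pos by simp
  finally show ?thesis by simp
qed

lemma integral_phi_x: "(LINT x|lborel. \<phi>x t x) = 0"
  using tail_phi_x[of t "-R"] tail_eq_integral(3)[of "-R" t] support(1)[of "-R"] R_pos by simp

text \<open>On an interval of length \<open>\<bar>z\<bar>\<close> the integrand stays within
  \<open>L * \<bar>z\<bar>\<close> of its value at \<open>y\<close>; the sign of \<open>z\<close>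
  decides on which side of \<open>y\<close> the interval lies.\<close>

lemma tail_diff_space: "\<bar>tail_int (\<phi> t) (y + z) - tail_int (\<phi> t) y + z * \<phi> t y\<bar> \<le> L * z\<^sup>2"
proof (cases "z \<ge> 0")
  case True
  have "\<bar>tail_int (\<phi> t) y - tail_int (\<phi> t) (y + z) - (y + z - y) * \<phi> t y\<bar> \<le> (y + z - y) * (L * z)"
  proof (rule tail_int_diff[OF integrable_slices(1)])
    fix x assume "y \<le> x" "x < y + z"
    then show "\<bar>\<phi> t x - \<phi> t y\<bar> \<le> L * z"
      using lip[of t x t y] mult_left_mono[of "\<bar>x - y\<bar>" z L] L_nonneg by auto
  qed (use True in auto)
  moreover have "(y + z - y) * \<phi> t y = z * \<phi> t y" "(y + z - y) * (L * z) = L * z\<^sup>2"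
    by (simp_all add: power2_eq_square)
  ultimately show ?thesis by linarith
next
  case False
  have "\<bar>tail_int (\<phi> t) (y + z) - tail_int (\<phi> t) y - (y - (y + z)) * \<phi> t y\<bar> \<le> (y - (y + z)) * (L * (- z))"
  proof (rule tail_int_diff[OF integrable_slices(1)])
    fix x assume "y + z \<le> x" "x < y"
    then show "\<bar>\<phi> t x - \<phi> t y\<bar> \<le> L * (- z)"
      using lip[of t x t y] mult_left_mono[of "\<bar>x - y\<bar>" "- z" L] L_nonneg by auto
  qed (use False in auto)
  moreover have "(y - (y + z)) * \<phi> t y = - (z * \<phi> t y)" "(y - (y + z)) * (L * (- z)) = L * z\<^sup>2"
    by (simp_all add: power2_eq_square)
  ultimately show ?thesis by linarith
qed

text \<open>The mean value theorem moves \<open>\<phi>t\<close> to an intermediate time, and its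
  Lipschitz bound supplies the second factor \<open>\<bar>h\<bar>\<close>.\<close>

lemma phi_diff_time: "\<bar>\<phi> (t + h) x - \<phi> t x - h * \<phi>t t x\<bar> \<le> L * h\<^sup>2"
proof (cases "h = 0")
  case False
  obtain s where s: "\<bar>s - t\<bar> \<le> \<bar>h\<bar>" "\<phi> (t + h) x - \<phi> t x = h * \<phi>t s x"
  proof (cases "h > 0")
    case True
    then show ?thesis
      using MVT2[of t "t + h" "\<lambda>s. \<phi> s x" "\<lambda>s. \<phi>t s x"] deriv_t that by force
  next
    case False
    then have "t + h < t" using \<open>h \<noteq> 0\<close> by simp
    then obtain s where "t + h < s" "s < t" "\<phi> t x - \<phi> (t + h) x = (t - (t + h)) * \<phi>t s x"
      using MVT2[of "t + h" t "\<lambda>s. \<phi> s x" "\<lambda>s. \<phi>t s x"] deriv_t by blast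
    then show ?thesis using that[of s] by (simp add: algebra_simps)
  qed
  have "\<bar>\<phi> (t + h) x - \<phi> t x - h * \<phi>t t x\<bar> = \<bar>h\<bar> * \<bar>\<phi>t s x - \<phi>t t x\<bar>"
    unfolding s(2) by (simp only: right_diff_distrib[symmetric] abs_mult)
  also have "\<dots> \<le> \<bar>h\<bar> * (L * \<bar>h\<bar>)"
    using lip_t[of s x t x] mult_left_mono[OF s(1) L_nonneg] by (intro mult_left_mono) auto
  also have "\<dots> = L * (\<bar>h\<bar> * \<bar>h\<bar>)" by (rule mult.left_commute)
  also have "\<dots> = L * h\<^sup>2" by (simp add: power2_eq_square)
  finally show ?thesis .
qed (simp add: L_nonneg)

lemma tail_int_bound:
  assumes "integrable lborel f" "\<And>x. \<bar>x\<bar> \<ge> R \<Longrightarrow> f x = 0" and bound: "\<And>x. \<bar>f x\<bar> \<le> B"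
  shows "\<bar>tail_int f y\<bar> \<le> 2 * R * B"
proof -
  have le: "\<bar>indicator {y..} x * f x\<bar> \<le> indicator {-R..R} x * B" for x
  proof (cases "y \<le> x \<and> \<bar>x\<bar> < R")
    case True
    then have "-R \<le> x" "x \<le> R" "y \<le> x" by linarith+
    then show ?thesis using bound[of x] by simp
  next
    case False
    then have eq: "indicator {y..} x * f x = 0" using assms(2)[of x] by auto
    have "0 \<le> B" using bound[of x] by simp
    then show ?thesis unfolding eq by simp
  qed
  have "integrable lborel (\<lambda>x. indicator {-R..R} x * B)"
    using R_pos by (auto simp: integrable_mult_left_iff)
  then have "\<bar>tail_int f y\<bar> \<le> (LINT x|lborel. indicator {-R..R} x * B)"
    unfolding tail_int_def by (intro abs_integral_le integrable_tail assms(1) le)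
  also have "\<dots> = 2 * R * B" using R_pos by simp
  finally show ?thesis .
qed

lemma tail_diff_time:
  "\<bar>tail_int (\<phi> (t + h)) y - tail_int (\<phi> t) y - h * tail_int (\<phi>t t) y\<bar> \<le> 2 * R * (L * h\<^sup>2)"
proof -
  have "\<bar>tail_int (\<lambda>x. \<phi> (t + h) x - \<phi> t x - h * \<phi>t t x) y\<bar> \<le> 2 * R * (L * h\<^sup>2)"
  proof (rule tail_int_bound)
    show "integrable lborel (\<lambda>x. \<phi> (t + h) x - \<phi> t x - h * \<phi>t t x)"
      by (intro integral_diff_diff_mult(1) integrable_slices)
    show "\<bar>\<phi> (t + h) x - \<phi> t x - h * \<phi>t t x\<bar> \<le> L * h\<^sup>2" for x
      by (rule phi_diff_time)
    show "\<phi> (t + h) x - \<phi> t x - h * \<phi>t t x = 0" if "R \<le> \<bar>x\<bar>" for x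
      unfolding support(1,2)[OF that] by simp
  qed
  then show ?thesis
    unfolding tail_int_linear[OF integrable_slices(1) integrable_slices(1) integrable_slices(2)] .
qed

text \<open>The tail is expanded in \<open>y\<close> at time \<open>t + h\<close> and then in time
  at \<open>y\<close>; the mismatch \<open>z * (\<phi> (t + h) y - \<phi> t y)\<close> has mixed
  order \<open>z * h\<close> and is absorbed into the squares. The spatial remainder and the
  mismatch cost one \<open>e\<close> each, the temporal remainder \<open>2 * R * e\<close>, whence
  the factor \<open>2 + 2 * R\<close>. A remainder quadratic in \<open>z\<close> is what an L2 bound
  on the increment of \<open>X\<close> controls.\<close>

lemma tail_expansion:
  "\<bar>tail_int (\<phi> (t + h)) (y + z) - tail_int (\<phi> t) y - h * tail_int (\<phi>t t) y + z * \<phi> t y\<bar>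
    \<le> L * (2 + 2 * R) * (h\<^sup>2 + z\<^sup>2)"
proof -
  define e where "e = L * (h\<^sup>2 + z\<^sup>2)"
  have "2 * (\<bar>z\<bar> * \<bar>h\<bar>) \<le> h\<^sup>2 + z\<^sup>2"
    using sum_squares_bound[of "\<bar>z\<bar>" "\<bar>h\<bar>"] by simp
  moreover have "0 \<le> \<bar>z\<bar> * \<bar>h\<bar>" by simp
  ultimately have "\<bar>z\<bar> * \<bar>h\<bar> \<le> h\<^sup>2 + z\<^sup>2" by linarith
  then have zh: "L * (\<bar>z\<bar> * \<bar>h\<bar>) \<le> e" unfolding e_def by (rule mult_left_mono) (rule L_nonneg)
  have "\<bar>\<phi> (t + h) y - \<phi> t y\<bar> \<le> L * \<bar>h\<bar>" using lip[of "t + h" y t y] by simp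
  then have "\<bar>z\<bar> * \<bar>\<phi> (t + h) y - \<phi> t y\<bar> \<le> \<bar>z\<bar> * (L * \<bar>h\<bar>)" by (rule mult_left_mono) simp
  then have "\<bar>z * (\<phi> (t + h) y - \<phi> t y)\<bar> \<le> L * (\<bar>z\<bar> * \<bar>h\<bar>)"
    by (simp only: abs_mult mult.left_commute)
  then have 1: "\<bar>z * \<phi> (t + h) y - z * \<phi> t y\<bar> \<le> e"
    using zh unfolding right_diff_distrib by (rule order_trans)
  have 2: "L * z\<^sup>2 \<le> e" unfolding e_def by (rule mult_left_mono) (simp_all add: L_nonneg)
  have "L * h\<^sup>2 \<le> e" unfolding e_def by (rule mult_left_mono) (simp_all add: L_nonneg)
  then have 3: "2 * R * (L * h\<^sup>2) \<le> 2 * R * e" by (rule mult_left_mono) (use R_pos in simp)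
  have triangle: "\<bar>a - c - d + f\<bar> \<le> e + e + r"
    if "\<bar>a - b + g\<bar> \<le> e" "\<bar>b - c - d\<bar> \<le> r" "\<bar>g - f\<bar> \<le> e" for a b c d f g r :: real
    using that by linarith
  have "\<bar>tail_int (\<phi> (t + h)) (y + z) - tail_int (\<phi> t) y - h * tail_int (\<phi>t t) y + z * \<phi> t y\<bar>
    \<le> e + e + 2 * R * e"
    by (rule triangle[OF order_trans[OF tail_diff_space[of "t + h" y z] 2]
          order_trans[OF tail_diff_time[of t h y] 3] 1])
  also have "\<dots> = L * (2 + 2 * R) * (h\<^sup>2 + z\<^sup>2)" unfolding e_def by (simp add: algebra_simps)
  finally show ?thesis .
qed

lemma tail_bound_t: "\<bar>tail_int (\<phi>t t) y\<bar> \<le> 2 * R * (2 * L * R)"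
  by (rule tail_int_bound[OF integrable_slices(2) support(2) bound(2)])

lemma tail_lipschitz_space:
  "\<bar>tail_int (\<phi> t) y - tail_int (\<phi> t) z\<bar> \<le> 2 * L * R * \<bar>y - z\<bar>"
  "\<bar>tail_int (\<phi>t t) y - tail_int (\<phi>t t) z\<bar> \<le> 2 * L * R * \<bar>y - z\<bar>"
proof -
  have mono: "\<bar>tail_int f y - tail_int f z\<bar> \<le> 2 * L * R * \<bar>y - z\<bar>"
    if f: "integrable lborel f" and bd: "\<And>x. \<bar>f x\<bar> \<le> 2 * L * R" and "y \<le> z" for f y z
  proof -
    have "\<bar>tail_int f y - tail_int f z - (z - y) * 0\<bar> \<le> (z - y) * (2 * L * R)"
      by (rule tail_int_diff[OF f \<open>y \<le> z\<close>]) (unfold diff_zero, rule bd)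
    then have "\<bar>tail_int f y - tail_int f z\<bar> \<le> (z - y) * (2 * L * R)"
      unfolding mult_zero_right diff_zero .
    also have "\<dots> = 2 * L * R * (z - y)" by (rule mult.commute)
    also have "z - y = \<bar>y - z\<bar>" using \<open>y \<le> z\<close> by linarith
    finally show ?thesis .
  qed
  have lip: "\<bar>tail_int f y - tail_int f z\<bar> \<le> 2 * L * R * \<bar>y - z\<bar>"
    if "integrable lborel f" "\<And>x. \<bar>f x\<bar> \<le> 2 * L * R" for f
  proof (cases "y \<le> z")
    case True
    show ?thesis by (rule mono[OF that True])
  next
    case False
    then have "z \<le> y" by simp
    from mono[OF that this] show ?thesis
      unfolding abs_minus_commute[of z y] abs_minus_commute[of "tail_int f z"] .
  qed
  show "\<bar>tail_int (\<phi> t) y - tail_int (\<phi> t) z\<bar> \<le> 2 * L * R * \<bar>y - z\<bar>"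
    by (rule lip[OF integrable_slices(1) bound(1)])
  show "\<bar>tail_int (\<phi>t t) y - tail_int (\<phi>t t) z\<bar> \<le> 2 * L * R * \<bar>y - z\<bar>"
    by (rule lip[OF integrable_slices(2) bound(2)])
qed

lemma tail_lipschitz_time:
  "\<bar>tail_int (\<phi> t) y - tail_int (\<phi> s) y\<bar> \<le> 2 * R * (L * \<bar>t - s\<bar>)"
proof -
  \<comment> \<open>The vanishing third term brings the difference into the form of
    \<open>tail_int_linear\<close>.\<close>
  have "\<bar>tail_int (\<lambda>x. \<phi> t x - \<phi> s x - 0 * \<phi> t x) y\<bar> \<le> 2 * R * (L * \<bar>t - s\<bar>)"
  proof (rule tail_int_bound)
    show "integrable lborel (\<lambda>x. \<phi> t x - \<phi> s x - 0 * \<phi> t x)"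
      by (intro integral_diff_diff_mult(1) integrable_slices)
    show "\<bar>\<phi> t x - \<phi> s x - 0 * \<phi> t x\<bar> \<le> L * \<bar>t - s\<bar>" for x
      using lip[of t x s x] by simp
    show "\<phi> t x - \<phi> s x - 0 * \<phi> t x = 0" if "R \<le> \<bar>x\<bar>" for x
      unfolding support(1,2)[OF that] by simp
  qed
  then show ?thesis
    unfolding tail_int_linear[OF integrable_slices(1) integrable_slices(1) integrable_slices(1)] by simp
qed

lemma tail_measurable [measurable]:
  "tail_int (\<phi> t) \<in> borel_measurable borel" "tail_int (\<phi>t t) \<in> borel_measurable borel"
proof -
  have "(2 * L * R)-lipschitz_on UNIV (tail_int (\<phi> t))" "(2 * L * R)-lipschitz_on UNIV (tail_int (\<phi>t t))"
    using tail_lipschitz_space L_nonneg R_pos by (auto intro!: lipschitz_onI simp: dist_real_def)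
  then show "tail_int (\<phi> t) \<in> borel_measurable borel" "tail_int (\<phi>t t) \<in> borel_measurable borel"
    by (auto intro!: borel_measurable_continuous_onI lipschitz_on_continuous_on)
qed

end

section \<open>Fubini over sublevel sets\<close>

lemma sublevel_pair_measurable:
  fixes X :: "real \<Rightarrow> real"
  assumes [measurable]: "X \<in> borel_measurable mu"
  shows "(\<lambda>p. indicator {..fst p} (X (snd p)) :: real) \<in> borel_measurable (lborel \<Otimes>\<^sub>M mu)"
proof -
  have "(\<lambda>p. if X (snd p) \<le> fst p then 1 else 0 :: real) \<in> borel_measurable (lborel \<Otimes>\<^sub>M mu)"
    by measurable
  then show ?thesis by (simp add: indicator_def of_bool_def)
qed

lemma integrable_pair_mult:
  assumes f: "integrable lborel f" and g: "integrable mu (g :: real \<Rightarrow> real)"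
  shows "integrable (lborel \<Otimes>\<^sub>M mu) (\<lambda>p. f (fst p) * g (snd p) :: real)"
proof (rule lborel_mu.Fubini_integrable)
  have [measurable]: "f \<in> borel_measurable lborel" "g \<in> borel_measurable mu"
    using f g by simp_all
  show "(\<lambda>p. f (fst p) * g (snd p)) \<in> borel_measurable (lborel \<Otimes>\<^sub>M mu)" by measurable
  show "integrable lborel (\<lambda>x. LINT m|mu. norm (f (fst (x, m)) * g (snd (x, m))))"
    using f by (simp add: abs_mult)
  show "AE x in lborel. integrable mu (\<lambda>m. f (fst (x, m)) * g (snd (x, m)))"
    using g by simp
qed

lemma integrable_pair_sublevel:
  fixes X :: "real \<Rightarrow> real"
  assumes f: "integrable lborel f" and g: "integrable mu g" and X: "X \<in> borel_measurable mu"
  shows "integrable (lborel \<Otimes>\<^sub>M mu) (\<lambda>p. f (fst p) * (g (snd p) * indicator {..fst p} (X (snd p))) :: real)"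
proof (rule Bochner_Integration.integrable_bound[OF integrable_pair_mult[OF f g]])
  have [measurable]: "f \<in> borel_measurable lborel" "g \<in> borel_measurable mu"
    using f g by simp_all
  note [measurable] = sublevel_pair_measurable[OF X]
  show "(\<lambda>p. f (fst p) * (g (snd p) * indicator {..fst p} (X (snd p)))) \<in> borel_measurable (lborel \<Otimes>\<^sub>M mu)"
    by measurable
  show "AE p in lborel \<Otimes>\<^sub>M mu. norm (f (fst p) * (g (snd p) * indicator {..fst p} (X (snd p))))
      \<le> norm (f (fst p) * g (snd p))"
    by (auto simp: indicator_def)
qed

text \<open>For fixed \<open>m\<close> the indicator, as a function of \<open>x\<close>, cuts out
  the half-line from \<open>X m\<close> on, so the inner integral over \<open>x\<close> is a tail of
  \<open>f\<close>. Exchange is allowed because the indicator is bounded by 1 and multiplies an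
  integrable product.\<close>

lemma Fubini_sublevel:
  fixes X :: "real \<Rightarrow> real"
  assumes f: "integrable lborel f" and g: "integrable mu g" and X: "X \<in> borel_measurable mu"
  shows "(LINT x|lborel. f x * (LINT m|mu. g m * indicator {..x} (X m))) = (LINT m|mu. g m * tail_int f (X m))"
    and "integrable lborel (\<lambda>x. f x * (LINT m|mu. g m * indicator {..x} (X m)))"
proof -
  note int = integrable_pair_sublevel[OF f g X]
  have "(LINT m|mu. LINT x|lborel. f x * (g m * indicator {..x} (X m)))
      = (LINT x|lborel. LINT m|mu. f x * (g m * indicator {..x} (X m)))"
    using lborel_mu.Fubini_integral[of "\<lambda>x m. f x * (g m * indicator {..x} (X m))"] int
    by (simp add: case_prod_beta')
  moreover have "(LINT x|lborel. f x * (g m * indicator {..x} (X m))) = g m * tail_int f (X m)" for m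
  proof -
    have "(LINT x|lborel. f x * (g m * indicator {..x} (X m)))
      = (LINT x|lborel. g m * (indicator {X m..} x * f x))"
      by (rule Bochner_Integration.integral_cong) (auto simp: indicator_def)
    then show ?thesis by (simp add: tail_int_def)
  qed
  ultimately show "(LINT x|lborel. f x * (LINT m|mu. g m * indicator {..x} (X m))) = (LINT m|mu. g m * tail_int f (X m))"
    by simp
  show "integrable lborel (\<lambda>x. f x * (LINT m|mu. g m * indicator {..x} (X m)))"
    using lborel_mu.integrable_fst'[OF int] by simp
qed

lemma integrable_mu_bounded:
  assumes "f \<in> borel_measurable mu" "\<And>m. \<bar>f m\<bar> \<le> (B::real)"
  shows "integrable mu f"
  using assms by (intro mu.integrable_const_bound[where B = B]) auto

lemma sublevel_measurable:
  fixes X :: "real \<Rightarrow> real"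
  assumes "X \<in> borel_measurable mu"
  shows "(\<lambda>m. indicator {..x} (X m) :: real) \<in> borel_measurable mu"
  by (rule measurable_compose[OF assms]) measurable

lemma integrable_mu_sublevel:
  fixes X :: "real \<Rightarrow> real"
  assumes "X \<in> borel_measurable mu"
  shows "integrable mu (\<lambda>m. indicator {..x} (X m) :: real)"
proof (rule integrable_mu_bounded[OF sublevel_measurable[OF assms]])
  show "\<bar>indicator {..x} (X m) :: real\<bar> \<le> 1" for m by (simp add: indicator_def)
qed

section \<open>Monotonicity, L1 stability and approximation of the generalized inverse\<close>

lemma gen_inv_mono:
  assumes X: "X \<in> borel_measurable mu" and "x \<le> y"
  shows "gen_inv X x \<le> gen_inv X y"
  unfolding gen_inv_eq[OF X]
  by (rule integral_mono) (use assms integrable_mu_sublevel in \<open>auto simp: indicator_def\<close>)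

lemma gen_inv_borel:
  assumes "X \<in> borel_measurable mu"
  shows "gen_inv X \<in> borel_measurable borel"
  using gen_inv_mono[OF assms] by (intro borel_measurable_mono) (auto simp: mono_def)

lemma integrable_indicator_Icc: "integrable lborel (\<lambda>x. indicator {a..b} x :: real)"
  for a b :: real
  by (cases "a \<le> b") auto

text \<open>Layer-cake argument: for fixed \<open>m\<close> the two indicators differ, as functions
  of \<open>x\<close>, only between \<open>X m\<close> and \<open>Y m\<close>, a set of length
  \<open>\<bar>X m - Y m\<bar>\<close>. This is the source of the continuity of \<open>M\<close> in
  time with values in local L1.\<close>

lemma gen_inv_L1_contraction:
  assumes X: "L2 X" and Y: "L2 Y"
  shows "(LINT x|lborel. indicator {a..b} x * \<bar>gen_inv X x - gen_inv Y x\<bar>) \<le> (LINT m|mu. \<bar>X m - Y m\<bar>)"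
proof -
  note [measurable] = L2_measurable[OF X] L2_measurable[OF Y]
    sublevel_pair_measurable[OF L2_measurable[OF X]] sublevel_pair_measurable[OF L2_measurable[OF Y]]
  let ?d = "\<lambda>x m. \<bar>indicator {..x} (X m) - indicator {..x} (Y m)\<bar> :: real"
  have int: "integrable (lborel \<Otimes>\<^sub>M mu) (\<lambda>p. indicator {a..b} (fst p) * ?d (fst p) (snd p))"
  proof (rule Bochner_Integration.integrable_bound)
    show "integrable (lborel \<Otimes>\<^sub>M mu) (\<lambda>p. indicator {a..b} (fst p) * (1::real))"
      by (rule integrable_pair_mult[OF integrable_indicator_Icc]) simp
    show "(\<lambda>p. indicator {a..b} (fst p) * ?d (fst p) (snd p)) \<in> borel_measurable (lborel \<Otimes>\<^sub>M mu)"
      by measurable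
    show "AE p in lborel \<Otimes>\<^sub>M mu. norm (indicator {a..b} (fst p) * ?d (fst p) (snd p)) \<le>
        norm (indicator {a..b} (fst p) * (1::real))"
      by (auto simp: indicator_def)
  qed
  have dint: "integrable mu (?d x)" for x
    by (intro integrable_abs Bochner_Integration.integrable_diff integrable_mu_sublevel L2_measurable X Y)
  have le: "\<bar>gen_inv X x - gen_inv Y x\<bar> \<le> (LINT m|mu. ?d x m)" for x
  proof -
    have "gen_inv X x - gen_inv Y x = (LINT m|mu. indicator {..x} (X m) - indicator {..x} (Y m))"
      unfolding gen_inv_eq[OF L2_measurable[OF X]] gen_inv_eq[OF L2_measurable[OF Y]]
      by (rule Bochner_Integration.integral_diff[symmetric])
        (simp_all add: integrable_mu_sublevel L2_measurable X Y)
    then show ?thesis using integral_abs_bound by simp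
  qed
  have "(LINT x|lborel. indicator {a..b} x * \<bar>gen_inv X x - gen_inv Y x\<bar>)
      \<le> (LINT x|lborel. LINT m|mu. indicator {a..b} x * ?d x m)"
  proof (rule integral_mono_AE')
    show "integrable lborel (\<lambda>x. LINT m|mu. indicator {a..b} x * ?d x m)"
      using lborel_mu.integrable_fst'[OF int] by simp
    show "AE x in lborel. indicator {a..b} x * \<bar>gen_inv X x - gen_inv Y x\<bar>
        \<le> (LINT m|mu. indicator {a..b} x * ?d x m)"
      using le by (auto intro!: mult_left_mono)
  qed auto
  also have "\<dots> = (LINT m|mu. LINT x|lborel. indicator {a..b} x * ?d x m)"
    using lborel_mu.Fubini_integral[of "\<lambda>x m. indicator {a..b} x * ?d x m"] int
    by (simp add: case_prod_beta')
  also have "\<dots> \<le> (LINT m|mu. \<bar>X m - Y m\<bar>)"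
  proof (rule integral_mono_AE')
    show "integrable mu (\<lambda>m. \<bar>X m - Y m\<bar>)" using L2_integrable[OF L2_abs[OF L2_diff[OF X Y]]] .
    show "AE m in mu. (LINT x|lborel. indicator {a..b} x * ?d x m) \<le> \<bar>X m - Y m\<bar>"
    proof (rule AE_I2)
      fix m
      have "(LINT x|lborel. indicator {a..b} x * ?d x m) \<le> (LINT x|lborel. indicator {min (X m) (Y m)..max (X m) (Y m)} x)"
        by (rule integral_mono_AE') (rule integrable_indicator_Icc, auto simp: indicator_def)
      also have "\<dots> = \<bar>X m - Y m\<bar>" by (auto simp: min_def max_def)
      finally show "(LINT x|lborel. indicator {a..b} x * ?d x m) \<le> \<bar>X m - Y m\<bar>" .
    qed
  qed auto
  finally show ?thesis .
qed

text \<open>These functions are continuous in \<open>(t, x)\<close> along the flow, which gives joint measurability of their limit \<open>M\<close>.\<close>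

definition mollified_inv :: "(real \<Rightarrow> real) \<Rightarrow> nat \<Rightarrow> real \<Rightarrow> real" where
  "mollified_inv X n x = (LINT m|mu. max 0 (min 1 (1 + real n * (x - X m))))"

text \<open>Clipping to \<open>[0, 1]\<close> is 1-Lipschitz and the ramp has slope
  \<open>n\<close>. The constant grows with \<open>n\<close>, which is harmless since only
  measurability has to pass to the limit.\<close>

lemma mollified_inv_lipschitz:
  assumes X: "L2 X" and Y: "L2 Y"
  shows "\<bar>mollified_inv X n x - mollified_inv Y n y\<bar> \<le> real n * (\<bar>x - y\<bar> + L2norm (\<lambda>m. X m - Y m))"
proof -
  let ?c = "\<lambda>Z z m. max 0 (min 1 (1 + real n * (z - Z m)))"
  have int: "integrable mu (?c Z z)" if "Z \<in> borel_measurable mu" for Z z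
  proof (rule integrable_mu_bounded)
    show "?c Z z \<in> borel_measurable mu"
      by (rule measurable_compose[OF that]) measurable
    show "\<bar>?c Z z m\<bar> \<le> 1" for m by linarith
  qed
  note int = int[OF L2_measurable[OF X], of x] int[OF L2_measurable[OF Y], of y]
  have D: "integrable mu (\<lambda>m. \<bar>X m - Y m\<bar>)" using L2_integrable[OF L2_abs[OF L2_diff[OF X Y]]] .
  have C: "integrable mu (\<lambda>m. \<bar>x - y\<bar>)" by simp
  note CD = Bochner_Integration.integrable_add[OF C D]
  have eq: "mollified_inv X n x - mollified_inv Y n y = (LINT m|mu. ?c X x m - ?c Y y m)"
    unfolding mollified_inv_def by (rule Bochner_Integration.integral_diff[symmetric, OF int])
  have "\<bar>mollified_inv X n x - mollified_inv Y n y\<bar> \<le> (LINT m|mu. real n * (\<bar>x - y\<bar> + \<bar>X m - Y m\<bar>))"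
    unfolding eq
  proof (rule abs_integral_le)
    show "\<bar>?c X x m - ?c Y y m\<bar> \<le> real n * (\<bar>x - y\<bar> + \<bar>X m - Y m\<bar>)" for m
    proof -
      have clip: "\<bar>max 0 (min 1 (1 + u)) - max 0 (min 1 (1 + v))\<bar> \<le> \<bar>u - v\<bar>" for u v :: real
        unfolding max_def min_def by (smt (verit))
      have "\<bar>?c X x m - ?c Y y m\<bar> \<le> \<bar>real n * (x - X m) - real n * (y - Y m)\<bar>" by (rule clip)
      also have "\<dots> = real n * \<bar>(x - X m) - (y - Y m)\<bar>"
        unfolding right_diff_distrib[symmetric] abs_mult by simp
      also have "\<dots> \<le> real n * (\<bar>x - y\<bar> + \<bar>X m - Y m\<bar>)"
      proof (rule mult_left_mono)
        show "\<bar>(x - X m) - (y - Y m)\<bar> \<le> \<bar>x - y\<bar> + \<bar>X m - Y m\<bar>" by linarith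
      qed simp
      finally show ?thesis .
    qed
    show "integrable mu (\<lambda>m. ?c X x m - ?c Y y m)"
      by (rule Bochner_Integration.integrable_diff[OF int])
    show "integrable mu (\<lambda>m. real n * (\<bar>x - y\<bar> + \<bar>X m - Y m\<bar>))"
      by (rule integrable_mult_right[OF CD])
  qed
  also have "\<dots> = real n * (\<bar>x - y\<bar> + (LINT m|mu. \<bar>X m - Y m\<bar>))"
    unfolding integral_mult_right_zero Bochner_Integration.integral_add[OF C D] by simp
  also have "\<dots> \<le> real n * (\<bar>x - y\<bar> + L2norm (\<lambda>m. X m - Y m))"
    by (rule mult_left_mono[OF add_left_mono[OF integral_abs_le_L2norm[OF L2_diff[OF X Y]]]]) simp
  finally show ?thesis .
qed

text \<open>For \<open>n > 0\<close> the ramp is 1 where \<open>X m \<le> x\<close> and 0 where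
  \<open>X m \<ge> x + 1 / n\<close>. The offset 1 gives the correct value at \<open>X m = x\<close>
  as well, so the limit is the right-continuous inverse at every \<open>x\<close>.\<close>

lemma mollified_inv_tendsto:
  assumes X: "L2 X"
  shows "(\<lambda>n. mollified_inv X n x) \<longlonglongrightarrow> gen_inv X x"
  unfolding mollified_inv_def gen_inv_eq[OF L2_measurable[OF X]]
proof (rule integral_dominated_convergence[where w = "\<lambda>_. 1"])
  show "(\<lambda>m. max 0 (min 1 (1 + real n * (x - X m)))) \<in> borel_measurable mu" for n
    by (rule measurable_compose[OF L2_measurable[OF X]]) measurable
  show "(\<lambda>m. indicator {..x} (X m) :: real) \<in> borel_measurable mu"
    by (rule sublevel_measurable[OF L2_measurable[OF X]])
  show "AE m in mu. (\<lambda>n. max 0 (min 1 (1 + real n * (x - X m)))) \<longlonglongrightarrow> indicator {..x} (X m)"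
  proof (rule AE_I2)
    fix m
    show "(\<lambda>n. max 0 (min 1 (1 + real n * (x - X m)))) \<longlonglongrightarrow> indicator {..x} (X m)"
    proof (cases "X m \<le> x")
      case True
      then have "max 0 (min 1 (1 + real n * (x - X m))) = 1" for n by simp
      then show ?thesis using True by simp
    next
      case False
      then obtain N where N: "1 / (X m - x) < real N" using reals_Archimedean2 by blast
      have "max 0 (min 1 (1 + real n * (x - X m))) = 0" if "n \<ge> N" for n
      proof -
        have "1 / (X m - x) \<le> real n" using N that by (simp add: order_less_le_trans less_imp_le)
        then have "1 \<le> real n * (X m - x)" using False by (simp add: divide_le_eq)
        then show ?thesis by (simp add: right_diff_distrib)
      qed
      then have "\<forall>\<^sub>F n in sequentially. max 0 (min 1 (1 + real n * (x - X m))) = 0"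
        by (auto simp: eventually_sequentially)
      then show ?thesis using False by (simp add: tendsto_eventually)
    qed
  qed
qed auto

section \<open>Increments of Lipschitz functions and the normal cone\<close>

text \<open>The forward difference quotients integrate, by telescoping, to nearly the increment of
  \<open>G\<close>; they are bounded by \<open>K\<close> and converge almost everywhere to a
  derivative below \<open>J\<close>. Dominated convergence is applied to the positive part of
  quotient minus \<open>J\<close>, because \<open>J\<close> bounds the derivative only from
  above.\<close>

lemma lipschitz_increment_le_integral:
  fixes G J :: "real \<Rightarrow> real"
  assumes T: "T > 0" and K: "K \<ge> 0"
    and lip: "\<And>s t. s \<in> {0..T} \<Longrightarrow> t \<in> {0..T} \<Longrightarrow> \<bar>G t - G s\<bar> \<le> K * \<bar>t - s\<bar>"
    and deriv: "AE t in lborel. t \<in> {0<..<T} \<longrightarrow> (\<exists>D. (G has_real_derivative D) (at t) \<and> D \<le> J t)"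
    and J: "set_integrable lborel {0<..<T} J"
  shows "G T - G 0 \<le> (LINT t:{0<..<T}|lborel. J t)"
proof -
  \<comment> \<open>Extends \<open>G\<close> by constants beyond \<open>[0, T]\<close>, so that
    forward quotients make sense up to \<open>T\<close>.\<close>
  define c where "c t = max 0 (min T t)" for t
  define H where "H t = G (c t)" for t
  have c: "c t \<in> {0..T}" "\<bar>c t - c s\<bar> \<le> \<bar>t - s\<bar>" for s t
    using T by (auto simp: c_def max_def min_def)
  have H_lip: "\<bar>H t - H s\<bar> \<le> K * \<bar>t - s\<bar>" for s t
  proof -
    have "\<bar>H t - H s\<bar> \<le> K * \<bar>c t - c s\<bar>" unfolding H_def by (rule lip[OF c(1) c(1)])
    also have "\<dots> \<le> K * \<bar>t - s\<bar>" by (rule mult_left_mono[OF c(2) K])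
    finally show ?thesis .
  qed
  have "K-lipschitz_on UNIV H" using H_lip K by (auto intro!: lipschitz_onI simp: dist_real_def)
  then have H_cont: "continuous_on S H" for S
    by (meson continuous_on_subset lipschitz_on_continuous_on subset_UNIV)
  define h where "h n = 1 / real (Suc n)" for n
  have h_pos: "h n > 0" for n by (simp add: h_def)
  have h_lim: "h \<longlonglongrightarrow> 0" unfolding h_def by (rule LIMSEQ_Suc[OF lim_1_over_n])
  define q where "q n t = (H (t + h n) - H t) / h n" for n t
  have q_cont: "continuous_on S (q n)" for n S
    unfolding q_def using h_pos[of n]
    by (intro continuous_intros H_cont continuous_on_compose2[OF H_cont[of UNIV]]) auto
  have q_bound: "\<bar>q n t\<bar> \<le> K" for n t
    using H_lip[of "t + h n" t] h_pos[of n] by (simp add: q_def field_simps)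
  have q_int: "set_integrable lborel {0<..<T} (q n)" for n
    by (rule set_integrable_subset[OF borel_integrable_atLeastAtMost'[OF q_cont[of "{0..T}" n]]]) auto
  \<comment> \<open>The integral of the quotient is the mean of \<open>H\<close> over
    \<open>[T, T + h n]\<close>, which is exactly \<open>G T\<close>, minus its mean over
    \<open>[0, h n]\<close>, which exceeds \<open>G 0\<close> by at most
    \<open>K * h n\<close>.\<close>
  have lower: "G T - G 0 - K * h n \<le> (LINT t:{0<..<T}|lborel. q n t)" for n
  proof -
    have I: "H integrable_on {a..b}" for a b by (rule integrable_continuous_real[OF H_cont])
    have "(LINT t:{0<..<T}|lborel. q n t) = integral {0..T} (q n)"
      using set_borel_integral_eq_integral(2)[OF q_int[of n]] integral_open_interval[of 0 T "q n"]
      by (simp add: box_real)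
    also have "\<dots> = (integral {0..T} (\<lambda>t. H (t + h n)) - integral {0..T} H) / h n"
    proof -
      have "(\<lambda>t. H (t + h n)) integrable_on {0..T}"
        by (intro integrable_continuous_real continuous_intros continuous_on_compose2[OF H_cont[of UNIV]]) auto
      moreover have "q n = (\<lambda>t. (H (t + h n) - H t) / h n)" by (simp add: q_def fun_eq_iff)
      ultimately show ?thesis
        using Henstock_Kurzweil_Integration.integral_diff[of "\<lambda>t. H (t + h n)" "{0..T}" H] I[of 0 T]
        by simp
    qed
    also have "integral {0..T} (\<lambda>t. H (t + h n)) = integral {h n..T + h n} H"
      using integral_shift[OF H_cont, of 0 T "h n"] by (simp add: o_def)
    also have "integral {h n..T + h n} H - integral {0..T} H = integral {T..T + h n} H - integral {0..h n} H"
      using Henstock_Kurzweil_Integration.integral_combine[of 0 "h n" "T + h n" H] 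
        Henstock_Kurzweil_Integration.integral_combine[of 0 T "T + h n" H] I T h_pos[of n]
      by (simp add: less_imp_le)
    also have "integral {T..T + h n} H = integral {T..T + h n} (\<lambda>_. G T)"
      by (rule Henstock_Kurzweil_Integration.integral_cong) (use T in \<open>simp add: H_def c_def\<close>)
    finally have eq: "(LINT t:{0<..<T}|lborel. q n t) = G T - integral {0..h n} H / h n"
      using h_pos[of n] by (simp add: diff_divide_distrib)
    have "integral {0..h n} H \<le> integral {0..h n} (\<lambda>_. G 0 + K * h n)"
    proof (rule integral_le[OF I])
      fix t assume t: "t \<in> {0..h n}"
      have "\<bar>H t - H 0\<bar> \<le> K * h n" using H_lip[of t 0] mult_left_mono[of t "h n" K] K t by simp
      moreover have "H 0 = G 0" using T by (simp add: H_def c_def)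
      ultimately show "H t \<le> G 0 + K * h n" by linarith
    qed auto
    then have "integral {0..h n} H / h n \<le> G 0 + K * h n"
      using h_pos[of n] by (simp add: field_simps)
    then show ?thesis unfolding eq by linarith
  qed
  have J_meas: "(\<lambda>t. indicator {0<..<T} t * J t) \<in> borel_measurable lborel"
    and J_int: "integrable lborel (\<lambda>t. indicator {0<..<T} t * J t)"
    using J by (auto simp: set_integrable_def)
  have q_int': "integrable lborel (\<lambda>t. indicator {0<..<T} t * q n t)" for n
    using q_int by (simp add: set_integrable_def)
  have K_int: "integrable lborel (\<lambda>t. indicator {0<..<T} t * K)"
    using T by (auto simp: integrable_mult_left_iff)
  define p where "p n t = max 0 (indicator {0<..<T} t * q n t - indicator {0<..<T} t * J t)" for n t
  have p_meas: "p n \<in> borel_measurable lborel" for n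
    unfolding p_def using q_int' J_meas by (intro borel_measurable_max borel_measurable_diff) auto
  have dom: "integrable lborel (\<lambda>t. indicator {0<..<T} t * K + \<bar>indicator {0<..<T} t * J t\<bar>)"
    by (rule Bochner_Integration.integrable_add[OF K_int integrable_abs[OF J_int]])
  have p_le: "\<bar>p n t\<bar> \<le> indicator {0<..<T} t * K + \<bar>indicator {0<..<T} t * J t\<bar>" for n t
    using q_bound[of n t] by (cases "t \<in> {0<..<T}") (simp_all add: p_def)
  have p_int: "integrable lborel (p n)" for n
    by (rule Bochner_Integration.integrable_bound[OF dom p_meas])
      (intro AE_I2, use p_le in \<open>simp add: order_trans[OF p_le abs_ge_self]\<close>)
  have "(\<lambda>n. LINT t|lborel. p n t) \<longlonglongrightarrow> integral\<^sup>L lborel (\<lambda>t::real. 0)"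
  proof (rule integral_dominated_convergence[where s = p])
    show "integrable lborel (\<lambda>t. indicator {0<..<T} t * K + \<bar>indicator {0<..<T} t * J t\<bar>)" by (rule dom)
    show "p n \<in> borel_measurable lborel" for n by (rule p_meas)
    show "AE t in lborel. (\<lambda>n. p n t) \<longlonglongrightarrow> 0"
      using deriv
    proof eventually_elim
      case (elim t)
      show ?case
      proof (cases "t \<in> {0<..<T}")
        case True
        then obtain D where D: "(G has_real_derivative D) (at t)" "D \<le> J t" using elim by blast
        have "(H has_real_derivative D) (at t)"
        proof (rule has_field_derivative_transform_within_open[OF D(1)])
          show "open {0<..<T}" "t \<in> {0<..<T}" using True by auto
          show "G s = H s" if "s \<in> {0<..<T}" for s using that by (simp add: H_def c_def)
        qed
        then have "((\<lambda>e. (H (t + e) - H t) / e) \<longlongrightarrow> D) (at 0)"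
          by (simp add: DERIV_def)
        moreover have "filterlim h (at 0) sequentially"
        proof -
          have "h n \<noteq> 0" for n using h_pos[of n] by simp
          then show ?thesis using h_lim by (simp add: filterlim_at)
        qed
        ultimately have "(\<lambda>n. q n t) \<longlonglongrightarrow> D"
          unfolding q_def by (rule filterlim_compose)
        then have "(\<lambda>n. max 0 (q n t - J t)) \<longlonglongrightarrow> max 0 (D - J t)"
          by (intro tendsto_intros)
        then show ?thesis using True D(2) by (simp add: p_def)
      next
        case False
        then show ?thesis by (simp add: p_def)
      qed
    qed
    show "AE t in lborel. norm (p n t) \<le> indicator {0<..<T} t * K + \<bar>indicator {0<..<T} t * J t\<bar>" for n
      using p_le by simp
  qed simp
  then have p_lim: "(\<lambda>n. LINT t|lborel. p n t) \<longlonglongrightarrow> 0" by simp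
  have upper: "(LINT t:{0<..<T}|lborel. q n t) \<le> (LINT t:{0<..<T}|lborel. J t) + (LINT t|lborel. p n t)" for n
  proof -
    have "(LINT t|lborel. indicator {0<..<T} t * q n t) \<le> (LINT t|lborel. indicator {0<..<T} t * J t + p n t)"
      by (rule integral_mono[OF q_int' Bochner_Integration.integrable_add[OF J_int p_int]])
        (simp add: p_def)
    also have "\<dots> = (LINT t|lborel. indicator {0<..<T} t * J t) + (LINT t|lborel. p n t)"
      by (rule Bochner_Integration.integral_add[OF J_int p_int])
    finally show ?thesis by (simp add: set_lebesgue_integral_def)
  qed
  have "G T - G 0 - K * 0 \<le> (LINT t:{0<..<T}|lborel. J t) + 0"
  proof (rule tendsto_le[OF sequentially_bot])
    show "(\<lambda>n. G T - G 0 - K * h n) \<longlonglongrightarrow> G T - G 0 - K * 0"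
      by (intro tendsto_intros h_lim)
    show "(\<lambda>n. (LINT t:{0<..<T}|lborel. J t) + (LINT t|lborel. p n t)) \<longlonglongrightarrow> (LINT t:{0<..<T}|lborel. J t) + 0"
      by (intro tendsto_intros p_lim)
    show "\<forall>\<^sub>F n in sequentially. G T - G 0 - K * h n \<le> (LINT t:{0<..<T}|lborel. J t) + (LINT t|lborel. p n t)"
      using lower upper by (intro always_eventually allI) (rule order_trans)
  qed
  then show ?thesis by simp
qed

text \<open>For small \<open>\<epsilon>\<close> the perturbation \<open>X + \<epsilon> sgn(m - k) f(X)\<close> is still nondecreasing: the
  Lipschitz bound handles each side of \<open>k\<close>, and the jump across \<open>k\<close> has the right sign.\<close>

lemma normal_cone_sgn:
  fixes f :: "real \<Rightarrow> real"
  assumes X: "X \<in> Kcone" and W: "W \<in> normal_cone X"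
    and f: "\<And>x. 0 \<le> f x" "\<And>x. f x \<le> B" and lip: "\<And>x y. \<bar>f x - f y\<bar> \<le> L * \<bar>x - y\<bar>"
    and L: "L \<ge> 0" and fm: "f \<in> borel_measurable borel"
  shows "(LINT m|mu. sgn (m - k) * f (X m) * W m) \<le> 0"
proof -
  \<comment> \<open>The step must satisfy \<open>e * L \<le> 1\<close>; the added 1 keeps the
    denominator positive when \<open>L = 0\<close>.\<close>
  define e where "e = 1 / (L + 1)"
  have e: "e > 0" "e * L \<le> 1" using L by (auto simp: e_def)
  define p where "p m = sgn (m - k) * f (X m)" for m
  define Y where "Y m = X m + e * p m" for m
  have Xm: "X \<in> borel_measurable mu" by (rule Kcone_measurable[OF X])
  have p_meas: "p \<in> borel_measurable mu"
    unfolding p_def by (intro borel_measurable_times sgn_shift_measurable_mu measurable_compose[OF Xm fm])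
  have p_bound: "\<bar>p m\<bar> \<le> B" for m
    using f(1)[of "X m"] f(2)[of "X m"] by (auto simp: p_def abs_mult sgn_if)
  have L2p: "L2 p" by (rule L2_bounded[OF p_meas p_bound])
  have "Y \<in> Kcone"
  proof -
    obtain Z where Z: "mono_on Omega Z" and XZ: "AE m in lebesgue. m \<in> Omega \<longrightarrow> X m = Z m"
      using X by (auto simp: Kcone_def)
    have "mono_on Omega (\<lambda>m. Z m + e * (sgn (m - k) * f (Z m)))"
    proof (rule mono_onI)
      fix m n assume mn: "m \<in> Omega" "n \<in> Omega" "m \<le> n"
      have le: "Z m \<le> Z n" by (rule mono_onD[OF Z mn])
      \<comment> \<open>The increment of the perturbation is the jump of the sign weighted by
        \<open>f (Z n)\<close>, nonnegative because \<open>f\<close> is, plus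
        \<open>sgn (m - k)\<close> times the increment of \<open>f\<close>, which is at least
        \<open>- L * (Z n - Z m)\<close>.\<close>
      have "sgn (m - k) \<le> sgn (n - k)" using mn by (simp add: sgn_if)
      then have 1: "0 \<le> (sgn (n - k) - sgn (m - k)) * f (Z n)" using f(1) by simp
      have "\<bar>sgn (m - k) * (f (Z n) - f (Z m))\<bar> \<le> 1 * (L * \<bar>Z n - Z m\<bar>)"
        unfolding abs_mult by (rule mult_mono[OF _ lip]) (auto simp: sgn_if)
      then have 2: "- (L * (Z n - Z m)) \<le> sgn (m - k) * (f (Z n) - f (Z m))" using le by simp
      have "- (L * (Z n - Z m)) \<le> sgn (n - k) * f (Z n) - sgn (m - k) * f (Z m)"
        using 1 2 by (simp add: algebra_simps)
      then have "e * - (L * (Z n - Z m)) \<le> e * (sgn (n - k) * f (Z n) - sgn (m - k) * f (Z m))"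
        using e(1) by (intro mult_left_mono) auto
      moreover have "e * L * (Z n - Z m) \<le> 1 * (Z n - Z m)"
        using le by (intro mult_right_mono[OF e(2)]) auto
      ultimately show "Z m + e * (sgn (m - k) * f (Z m)) \<le> Z n + e * (sgn (n - k) * f (Z n))"
        by (simp add: algebra_simps)
    qed
    moreover have "AE m in lebesgue. m \<in> Omega \<longrightarrow> Y m = Z m + e * (sgn (m - k) * f (Z m))"
      using XZ by eventually_elim (simp add: Y_def p_def)
    moreover have "L2 Y" unfolding Y_def by (rule L2_add[OF Kcone_L2[OF X] L2_cmult[OF L2p]])
    ultimately show ?thesis by (auto simp: Kcone_def)
  qed
  then have "L2inner W (\<lambda>m. Y m - X m) \<le> 0" using W by (simp add: normal_cone_def)
  also have "L2inner W (\<lambda>m. Y m - X m) = (LINT m|mu. e * (sgn (m - k) * f (X m) * W m))"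
    unfolding L2inner_eq by (rule Bochner_Integration.integral_cong) (auto simp: Y_def p_def)
  finally show ?thesis using e(1) by (simp add: mult_le_0_iff)
qed

section \<open>Space integrals of the entropy and of the entropy flux\<close>

lemma abs_entropy_integral:
  assumes X: "X \<in> Kcone" and f: "integrable lborel f"
  shows "(LINT x|lborel. \<bar>gen_inv X x - k\<bar> * f x)
      = (LINT m|mu. sgn (m - k) * tail_int f (X m)) + \<bar>k\<bar> * (LINT x|lborel. f x)"
    and "integrable lborel (\<lambda>x. \<bar>gen_inv X x - k\<bar> * f x)"
proof -
  have g: "integrable mu (\<lambda>m. sgn (m - k))"
    by (rule integrable_mu_bounded[OF sgn_shift_measurable_mu, where B = 1]) (simp add: abs_sgn_eq)
  note F = Fubini_sublevel[OF f g Kcone_measurable[OF X]]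
  have eq: "\<bar>gen_inv X x - k\<bar> * f x
      = f x * (LINT m|mu. sgn (m - k) * indicator {..x} (X m)) + \<bar>k\<bar> * f x" for x
    unfolding abs_entropy_eq[OF X] by (simp add: algebra_simps)
  note k = integrable_mult_right[OF f, of "\<bar>k\<bar>"]
  show "integrable lborel (\<lambda>x. \<bar>gen_inv X x - k\<bar> * f x)"
    unfolding eq by (rule Bochner_Integration.integrable_add[OF F(2) k])
  show "(LINT x|lborel. \<bar>gen_inv X x - k\<bar> * f x)
      = (LINT m|mu. sgn (m - k) * tail_int f (X m)) + \<bar>k\<bar> * (LINT x|lborel. f x)"
    unfolding eq Bochner_Integration.integral_add[OF F(2) k] F(1) by simp
qed

lemma flux_entropy_integral:
  assumes X: "X \<in> Kcone" and U: "L2 (U t)" and f: "integrable lborel f"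
  shows "(LINT x|lborel. sgn (gen_inv X x - k) * (flux U t (gen_inv X x) - flux U t k) * f x)
      = (LINT m|mu. sgn (m - k) * U t m * tail_int f (X m)) + flux U t k * (LINT x|lborel. f x)"
    and "integrable lborel (\<lambda>x. sgn (gen_inv X x - k) * (flux U t (gen_inv X x) - flux U t k) * f x)"
proof -
  have g: "integrable mu (\<lambda>m. sgn (m - k) * U t m)"
    by (rule L2_integrable[OF L2_mult_bounded[OF U sgn_shift_measurable_mu, where B = 1]])
      (simp add: abs_sgn_eq)
  note F = Fubini_sublevel[OF f g Kcone_measurable[OF X]]
  have eq: "sgn (gen_inv X x - k) * (flux U t (gen_inv X x) - flux U t k) * f x
      = f x * (LINT m|mu. sgn (m - k) * U t m * indicator {..x} (X m)) + flux U t k * f x" for x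
    unfolding flux_entropy_eq[of X U t, OF X U] by (simp add: algebra_simps)
  note k = integrable_mult_right[OF f, of "flux U t k"]
  show "integrable lborel (\<lambda>x. sgn (gen_inv X x - k) * (flux U t (gen_inv X x) - flux U t k) * f x)"
    unfolding eq by (rule Bochner_Integration.integrable_add[OF F(2) k])
  show "(LINT x|lborel. sgn (gen_inv X x - k) * (flux U t (gen_inv X x) - flux U t k) * f x)
      = (LINT m|mu. sgn (m - k) * U t m * tail_int f (X m)) + flux U t k * (LINT x|lborel. f x)"
    unfolding eq Bochner_Integration.integral_add[OF F(2) k] F(1) by simp
qed

section \<open>Lagrangian solutions\<close>

lemma L2inner_diff_left:
  assumes "L2 X" "L2 Y" "L2 Z"
  shows "L2inner (\<lambda>m. X m - Y m) Z = L2inner X Z - L2inner Y Z"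
  using L2_mult_integrable[OF assms(1,3)] L2_mult_integrable[OF assms(2,3)]
  by (simp add: L2inner_eq left_diff_distrib)

lemma L2inner_self: "L2inner X X = (L2norm X)\<^sup>2"
  unfolding L2inner_eq L2norm_power2 by (simp add: power2_eq_square)

lemma L2norm_minus_commute: "L2norm (\<lambda>m. X m - Y m) = L2norm (\<lambda>m. Y m - X m)"
  by (simp add: L2norm_eq power2_commute)

locale lagrangian =
  fixes F :: "(real \<Rightarrow> real) \<Rightarrow> (real \<Rightarrow> real)" and X0 V0 :: "real \<Rightarrow> real"
    and X U :: "real \<Rightarrow> real \<Rightarrow> real" and T :: real
  assumes F: "unif_cont_K F" and X0: "X0 \<in> Kcone" and V0: "L2 V0" and T: "T > 0"
    and sol: "lagrangian_solution F X0 V0 X U"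
begin

lemma X_Kcone: "t \<ge> 0 \<Longrightarrow> X t \<in> Kcone"
  using sol by (simp add: lagrangian_solution_def lip_loc_K_def)

lemma X_L2: "t \<ge> 0 \<Longrightarrow> L2 (X t)"
  by (rule Kcone_L2[OF X_Kcone])

lemma U_L2: "t \<ge> 0 \<Longrightarrow> L2 (U t)"
  using sol by (simp add: lagrangian_solution_def is_U_def)

lemma F_L2: "Y \<in> Kcone \<Longrightarrow> L2 (F Y)"
  using F by (simp add: unif_cont_K_def)

lemma X_lipschitz:
  obtains A where "A \<ge> 0"
    "\<And>s t. s \<in> {0..T} \<Longrightarrow> t \<in> {0..T} \<Longrightarrow> L2norm (\<lambda>m. X t m - X s m) \<le> A * \<bar>t - s\<bar>"
proof -
  obtain A where A: "\<And>s t. s \<in> {0..T} \<Longrightarrow> t \<in> {0..T} \<Longrightarrow> L2norm (\<lambda>m. X t m - X s m) \<le> A * \<bar>t - s\<bar>"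
  proof -
    have "\<exists>A. \<forall>s\<in>{0..T}. \<forall>t\<in>{0..T}. L2norm (\<lambda>m. X t m - X s m) \<le> A * \<bar>t - s\<bar>"
      using sol T unfolding lagrangian_solution_def lip_loc_K_def by blast
    then show thesis using that by blast
  qed
  show ?thesis
  proof
    show "\<bar>A\<bar> \<ge> 0" by simp
    show "L2norm (\<lambda>m. X t m - X s m) \<le> \<bar>A\<bar> * \<bar>t - s\<bar>" if "s \<in> {0..T}" "t \<in> {0..T}" for s t
      using A[OF that] mult_right_mono[of A "\<bar>A\<bar>" "\<bar>t - s\<bar>"] by linarith
  qed
qed

text \<open>Only pairings of the force with a fixed \<open>f\<close> are ever integrated in time.
  The modulus of continuity composed with the Lipschitz bound on \<open>X\<close> makes them
  continuous, and its maximum over the possible distances to \<open>X 0\<close> bounds them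
  uniformly in \<open>r\<close>.\<close>

lemma force_pairing:
  obtains C where "C \<ge> 0"
    "\<And>r f. r \<in> {0..T} \<Longrightarrow> L2 f \<Longrightarrow> \<bar>L2inner (F (X r)) f\<bar> \<le> C * L2norm f"
    "\<And>f. L2 f \<Longrightarrow> continuous_on {0..T} (\<lambda>r. L2inner (F (X r)) f)"
proof -
  obtain A where A: "A \<ge> 0"
    "\<And>s t. s \<in> {0..T} \<Longrightarrow> t \<in> {0..T} \<Longrightarrow> L2norm (\<lambda>m. X t m - X s m) \<le> A * \<bar>t - s\<bar>"
    using X_lipschitz by blast
  obtain w where w: "modulus_of_continuity w"
    "\<And>X1 X2. X1 \<in> Kcone \<Longrightarrow> X2 \<in> Kcone \<Longrightarrow> L2norm (\<lambda>m. F X1 m - F X2 m) \<le> w (L2norm (\<lambda>m. X1 m - X2 m))"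
    using F by (auto simp: unif_cont_K_def)
  have w_cont: "continuous_on {0..} w" and w0: "w 0 = 0"
    using w(1) by (auto simp: modulus_of_continuity_def)
  have pair: "\<bar>L2inner (F (X r)) f - L2inner (F (X s)) f\<bar> \<le> w (L2norm (\<lambda>m. X r m - X s m)) * L2norm f"
    if "r \<ge> 0" "s \<ge> 0" "L2 f" for r s f
  proof -
    have "\<bar>L2inner (F (X r)) f - L2inner (F (X s)) f\<bar> = \<bar>L2inner (\<lambda>m. F (X r) m - F (X s) m) f\<bar>"
      by (simp add: L2inner_diff_left F_L2 X_Kcone that)
    also have "\<dots> \<le> L2norm (\<lambda>m. F (X r) m - F (X s) m) * L2norm f"
      by (rule L2inner_le) (simp_all add: L2_diff F_L2 X_Kcone that)
    also have "\<dots> \<le> w (L2norm (\<lambda>m. X r m - X s m)) * L2norm f"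
      by (rule mult_right_mono) (simp_all add: w(2) X_Kcone that)
    finally show ?thesis .
  qed
  \<comment> \<open>\<open>A * T\<close> bounds the distance of \<open>X r\<close> from
    \<open>X 0\<close> for \<open>r\<close> in \<open>[0, T]\<close>.\<close>
  have "compact (w ` {0..A * T})"
    by (intro compact_continuous_image continuous_on_subset[OF w_cont]) auto
  then obtain B where B: "\<And>y. y \<in> {0..A * T} \<Longrightarrow> \<bar>w y\<bar> \<le> B"
    by (meson bounded_real compact_imp_bounded imageI)
  define C where "C = \<bar>B\<bar> + L2norm (F (X 0))"
  show ?thesis
  proof
    show "C \<ge> 0" by (simp add: C_def)
    fix f assume f: "L2 f"
    show "\<bar>L2inner (F (X r)) f\<bar> \<le> C * L2norm f" if r: "r \<in> {0..T}" for r
    proof -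
      have "A * \<bar>r - 0\<bar> \<le> A * T" using r A(1) by (intro mult_left_mono) auto
      then have "L2norm (\<lambda>m. X r m - X 0 m) \<in> {0..A * T}"
        using A(2)[of 0 r] r by auto
      then have "w (L2norm (\<lambda>m. X r m - X 0 m)) \<le> \<bar>B\<bar>" using B by fastforce
      then have "w (L2norm (\<lambda>m. X r m - X 0 m)) * L2norm f \<le> \<bar>B\<bar> * L2norm f"
        by (rule mult_right_mono) simp
      moreover have "\<bar>L2inner (F (X 0)) f\<bar> \<le> L2norm (F (X 0)) * L2norm f"
        by (rule L2inner_le) (simp_all add: F_L2 X_Kcone f)
      ultimately show ?thesis
        using pair[of r 0 f] r f by (simp add: C_def distrib_right)
    qed
    show "continuous_on {0..T} (\<lambda>r. L2inner (F (X r)) f)"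
      unfolding continuous_on_def
    proof
      fix s assume s: "s \<in> {0..T}"
      let ?d = "\<lambda>r. L2norm (\<lambda>m. X r m - X s m)"
      have "((\<lambda>r. A * \<bar>r - s\<bar>) \<longlongrightarrow> A * \<bar>s - s\<bar>) (at s within {0..T})"
        by (intro tendsto_intros)
      then have "((\<lambda>r. A * \<bar>r - s\<bar>) \<longlongrightarrow> 0) (at s within {0..T})" by simp
      then have d: "(?d \<longlongrightarrow> 0) (at s within {0..T})"
      proof (rule tendsto_0_le[where K = 1])
        show "\<forall>\<^sub>F r in at s within {0..T}. norm (?d r) \<le> norm (A * \<bar>r - s\<bar>) * 1"
          unfolding eventually_at_filter using A(2)[OF s] A(1) by (auto simp: abs_mult)
      qed
      have "((\<lambda>r. w (?d r)) \<longlongrightarrow> w 0) (at s within {0..T})"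
        by (rule continuous_on_tendsto_compose[OF w_cont d]) auto
      then have "((\<lambda>r. w (?d r) * L2norm f) \<longlongrightarrow> 0) (at s within {0..T})"
        using tendsto_mult_left_zero[of "\<lambda>r. w (?d r)"] w0 by simp
      then have "((\<lambda>r. L2inner (F (X r)) f - L2inner (F (X s)) f) \<longlongrightarrow> 0) (at s within {0..T})"
      proof (rule Lim_null_comparison[rotated])
        show "\<forall>\<^sub>F r in at s within {0..T}. norm (L2inner (F (X r)) f - L2inner (F (X s)) f) \<le> w (?d r) * L2norm f"
          unfolding eventually_at_filter using pair[OF _ _ f] s by auto
      qed
      then show "((\<lambda>r. L2inner (F (X r)) f) \<longlongrightarrow> L2inner (F (X s)) f) (at s within {0..T})"
        by (simp add: LIM_zero_iff)
    qed
  qed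
qed

text \<open>Duality: pairing the increment of \<open>U\<close> with itself bounds the square of its
  norm by \<open>C\<close> times the norm times the elapsed time, and one factor of the norm
  cancels.\<close>

lemma U_lipschitz:
  obtains C where "C \<ge> 0"
    "\<And>s t. s \<in> {0..T} \<Longrightarrow> t \<in> {0..T} \<Longrightarrow> L2norm (\<lambda>m. U t m - U s m) \<le> C * \<bar>t - s\<bar>"
proof -
  obtain C where C: "C \<ge> 0"
    "\<And>r f. r \<in> {0..T} \<Longrightarrow> L2 f \<Longrightarrow> \<bar>L2inner (F (X r)) f\<bar> \<le> C * L2norm f"
    "\<And>f. L2 f \<Longrightarrow> continuous_on {0..T} (\<lambda>r. L2inner (F (X r)) f)"
    using force_pairing by blast
  have U_inner: "L2inner (U t) f = L2inner V0 f + integral {0..t} (\<lambda>r. L2inner (F (X r)) f)"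
    if t: "t \<in> {0..T}" and f: "L2 f" for t f
  proof -
    have "L2inner (U t) f = L2inner V0 f + (LBINT r=0..t. L2inner (F (X r)) f)"
      using sol t f by (simp add: lagrangian_solution_def is_U_def)
    also have "(LBINT r=0..t. L2inner (F (X r)) f) = (LINT r:{0..t}|lborel. L2inner (F (X r)) f)"
      using t interval_integral_Icc[of 0 t] by (simp add: zero_ereal_def)
    also have "\<dots> = integral {0..t} (\<lambda>r. L2inner (F (X r)) f)"
      using t by (intro set_borel_integral_eq_integral(2) borel_integrable_atLeastAtMost'
          continuous_on_subset[OF C(3)[OF f]]) auto
    finally show ?thesis .
  qed
  have mono: "L2norm (\<lambda>m. U t m - U s m) \<le> C * (t - s)" if st: "s \<in> {0..T}" "t \<in> {0..T}" "s \<le> t" for s t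
  proof -
    define f where "f m = U t m - U s m" for m
    have f: "L2 f" unfolding f_def using st by (intro L2_diff U_L2) auto
    let ?g = "\<lambda>r. L2inner (F (X r)) f"
    have "L2inner (\<lambda>m. U t m - U s m) f = L2inner (U t) f - L2inner (U s) f"
      using st f by (intro L2inner_diff_left U_L2) auto
    then have "(L2norm f)\<^sup>2 = L2inner (U t) f - L2inner (U s) f"
      unfolding f_def[symmetric] L2inner_self .
    also have "\<dots> = integral {0..t} ?g - integral {0..s} ?g"
      using st f by (simp add: U_inner)
    also have "\<dots> = integral {s..t} ?g"
    proof -
      have "?g integrable_on {0..t}"
        using st by (intro integrable_continuous_real continuous_on_subset[OF C(3)[OF f]]) auto
      from Henstock_Kurzweil_Integration.integral_combine[OF _ _ this, of s] show ?thesis using st by simp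
    qed
    also have "\<dots> \<le> C * L2norm f * (t - s)"
    proof -
      have "norm (integral {s..t} ?g) \<le> C * L2norm f * (t - s)"
        by (rule integral_bound) (use st C(2) f in \<open>auto intro: continuous_on_subset[OF C(3)[OF f]]\<close>)
      then show ?thesis by simp
    qed
    finally have "L2norm f * L2norm f \<le> (C * (t - s)) * L2norm f"
      by (simp add: power2_eq_square mult_ac)
    \<comment> \<open>When the norm is 0 nothing can be cancelled, but the right-hand side is
      nonnegative.\<close>
    then have "L2norm f \<le> C * (t - s)"
      using C(1) st by (cases "L2norm f = 0") (auto simp: mult_le_cancel_right less_le)
    then show ?thesis by (simp add: f_def[abs_def])
  qed
  show ?thesis
  proof
    show "L2norm (\<lambda>m. U t m - U s m) \<le> C * \<bar>t - s\<bar>" if "s \<in> {0..T}" "t \<in> {0..T}" for s t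
    proof (cases "s \<le> t")
      case True
      then show ?thesis using mono[OF that True] by simp
    next
      case False
      then have "t \<le> s" by simp
      from mono[OF that(2,1) this] False show ?thesis by (simp add: L2norm_minus_commute[of "U t"])
    qed
  qed (rule C(1))
qed

end

section \<open>Regularity of the flux in time and in mass\<close>

lemma flux_diff_le:
  assumes "L2 (U t)" "L2 (U s)"
  shows "\<bar>flux U t m - flux U s m\<bar> \<le> L2norm (\<lambda>w. U t w - U s w)"
proof -
  have meas: "(\<lambda>w. indicator {..m} w :: real) \<in> borel_measurable mu" by (rule indicator_measurable_mu)
  have ind: "L2 (\<lambda>w. indicator {..m} w * f w)" if "L2 f" for f
    by (rule L2_mult_bounded[OF that meas, where B = 1]) (simp add: indicator_def)
  note i = L2_integrable[OF ind[OF assms(1)]] L2_integrable[OF ind[OF assms(2)]]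
  have "\<bar>flux U t m - flux U s m\<bar> = \<bar>LINT w|mu. indicator {..m} w * (U t w - U s w)\<bar>"
    unfolding flux_eq using i by (simp add: right_diff_distrib)
  also have "\<dots> \<le> (LINT w|mu. \<bar>U t w - U s w\<bar>)"
  proof (rule abs_integral_le)
    show "integrable mu (\<lambda>w. indicator {..m} w * (U t w - U s w))"
      by (rule L2_integrable[OF ind[OF L2_diff[OF assms]]])
    show "integrable mu (\<lambda>w. \<bar>U t w - U s w\<bar>)"
      by (rule L2_integrable[OF L2_abs[OF L2_diff[OF assms]]])
  qed (simp add: indicator_def)
  also have "\<dots> \<le> L2norm (\<lambda>w. U t w - U s w)"
    by (rule integral_abs_le_L2norm[OF L2_diff[OF assms]])
  finally show ?thesis .
qed

text \<open>Cauchy-Schwarz against the indicator of the interval between the two arguments. As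
  \<open>U t\<close> is only square integrable, the exponent is one half.\<close>

lemma flux_holder:
  assumes U: "L2 (U t)"
  shows "\<bar>flux U t m - flux U t n\<bar> \<le> sqrt \<bar>m - n\<bar> * L2norm (U t)"
proof -
  define g where "g w = indicator {..m} w - (indicator {..n} w :: real)" for w
  have meas: "(\<lambda>w. indicator {..a} w :: real) \<in> borel_measurable mu" for a by (rule indicator_measurable_mu)
  have g: "L2 g" unfolding g_def
    by (intro L2_diff L2_bounded[OF meas, where B = 1]) (simp_all add: indicator_def)
  have i: "integrable mu (\<lambda>w. indicator {..a} w * U t w)" for a
    by (rule L2_integrable[OF L2_mult_bounded[OF U meas, where B = 1]]) (simp add: indicator_def)
  have ind: "integrable mu (\<lambda>w. indicator {..a} w :: real)" for a
    by (rule integrable_mu_bounded[OF meas, where B = 1]) (simp add: indicator_def)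
  have id: "(LINT w|mu. indicator {..a} w) = min 1 (max 0 a)" for a :: real
    using gen_inv_eq[of "\<lambda>m. m" a] by (simp add: gen_inv_id borel_measurable_mu)
  have "(L2norm g)\<^sup>2 \<le> \<bar>m - n\<bar>"
  proof -
    \<comment> \<open>The square of a difference of nested indicators is the larger minus the
      smaller.\<close>
    have "(L2norm g)\<^sup>2 = (LINT w|mu. indicator {..max m n} w - indicator {..min m n} w)"
      unfolding L2norm_power2
      by (rule Bochner_Integration.integral_cong) (auto simp: g_def indicator_def max_def min_def)
    also have "\<dots> = min 1 (max 0 (max m n)) - min 1 (max 0 (min m n))"
      using ind by (simp only: Bochner_Integration.integral_diff id)
    also have "\<dots> \<le> \<bar>m - n\<bar>" by (simp add: max_def min_def)
    finally show ?thesis .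
  qed
  then have "L2norm g \<le> sqrt \<bar>m - n\<bar>" by (rule real_le_rsqrt)
  then have le: "L2norm g * L2norm (U t) \<le> sqrt \<bar>m - n\<bar> * L2norm (U t)" by (rule mult_right_mono) simp
  have eq: "flux U t m - flux U t n = L2inner g (U t)"
    unfolding flux_eq L2inner_eq g_def using i by (simp add: left_diff_distrib)
  show ?thesis unfolding eq using L2inner_le[OF g U] le by (rule order_trans)
qed

section \<open>Joint measurability of the inverse and joint continuity of the flux\<close>

context lagrangian
begin

text \<open>\<open>X t\<close> and \<open>U t\<close> are controlled only for
  \<open>t \<ge> 0\<close>, with Lipschitz constants on \<open>[0, T]\<close>. Clamping gives
  functions on the whole plane that agree with the original ones on the strip.\<close>

definition clamp_time :: "real \<Rightarrow> real" where
  "clamp_time t = max 0 (min T t)"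

lemma clamp_time: "clamp_time t \<in> {0..T}" "0 \<le> clamp_time t" "\<bar>clamp_time t - clamp_time s\<bar> \<le> \<bar>t - s\<bar>"
  "t \<in> {0..T} \<Longrightarrow> clamp_time t = t"
  using T by (auto simp: clamp_time_def max_def min_def)

text \<open>The inverse may jump in \<open>x\<close>, so continuity is out of reach; its
  mollifications are Lipschitz in both variables, hence Borel, and converge at every point.\<close>

lemma clamped_gen_inv_measurable:
  "(\<lambda>p. gen_inv (X (clamp_time (fst p))) (snd p)) \<in> borel_measurable borel"
proof (rule borel_measurable_LIMSEQ_real)
  obtain A where A: "A \<ge> 0"
    "\<And>s t. s \<in> {0..T} \<Longrightarrow> t \<in> {0..T} \<Longrightarrow> L2norm (\<lambda>m. X t m - X s m) \<le> A * \<bar>t - s\<bar>"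
    using X_lipschitz by blast
  let ?S = "\<lambda>n p. mollified_inv (X (clamp_time (fst p))) n (snd p)"
  show "(\<lambda>n. ?S n p) \<longlonglongrightarrow> gen_inv (X (clamp_time (fst p))) (snd p)" for p :: "real \<times> real"
    by (rule mollified_inv_tendsto) (rule X_L2[OF clamp_time(2)])
  show "?S n \<in> borel_measurable borel" for n
  proof (rule borel_measurable_continuous_onI, rule lipschitz_on_continuous_on, rule lipschitz_onI)
    fix p q :: "real \<times> real"
    have "L2norm (\<lambda>m. X (clamp_time (fst p)) m - X (clamp_time (fst q)) m)
        \<le> A * \<bar>clamp_time (fst p) - clamp_time (fst q)\<bar>"
      by (rule A(2)[OF clamp_time(1) clamp_time(1)])
    also have "\<dots> \<le> A * dist p q"
      using clamp_time(3)[of "fst p" "fst q"] dist_fst_le[of p q] A(1)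
      by (intro mult_left_mono) (auto simp: dist_real_def)
    finally have "\<bar>snd p - snd q\<bar> + L2norm (\<lambda>m. X (clamp_time (fst p)) m - X (clamp_time (fst q)) m)
        \<le> dist p q + A * dist p q"
      using dist_snd_le[of p q] by (simp add: dist_real_def)
    then have "real n * (\<bar>snd p - snd q\<bar> + L2norm (\<lambda>m. X (clamp_time (fst p)) m - X (clamp_time (fst q)) m))
        \<le> real n * (dist p q + A * dist p q)"
      by (rule mult_left_mono) simp
    then have "\<bar>?S n p - ?S n q\<bar> \<le> real n * (dist p q + A * dist p q)"
      using mollified_inv_lipschitz[OF X_L2[OF clamp_time(2)] X_L2[OF clamp_time(2)]] by (rule order_trans[rotated])
    then show "dist (?S n p) (?S n q) \<le> (real n * (1 + A)) * dist p q"
      by (simp add: dist_real_def algebra_simps)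
  qed (use A(1) in simp)
qed

lemma clamped_flux_continuous:
  "continuous_on UNIV (\<lambda>p. flux U (clamp_time (fst p)) (snd p))"
proof -
  obtain C where C: "C \<ge> 0"
    "\<And>s t. s \<in> {0..T} \<Longrightarrow> t \<in> {0..T} \<Longrightarrow> L2norm (\<lambda>m. U t m - U s m) \<le> C * \<bar>t - s\<bar>"
    using U_lipschitz by blast
  let ?f = "\<lambda>p. flux U (clamp_time (fst p)) (snd p)"
  have "(?f \<longlongrightarrow> ?f q) (at q)" for q :: "real \<times> real"
  proof -
    let ?e = "\<lambda>p. C * \<bar>fst p - fst q\<bar> + sqrt \<bar>snd p - snd q\<bar> * L2norm (U (clamp_time (fst q)))"
    have "(?e \<longlongrightarrow> C * \<bar>fst q - fst q\<bar> + sqrt \<bar>snd q - snd q\<bar> * L2norm (U (clamp_time (fst q)))) (at q)"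
      by (intro tendsto_intros)
    then have e: "(?e \<longlongrightarrow> 0) (at q)" by simp
    have "((\<lambda>p. ?f p - ?f q) \<longlongrightarrow> 0) (at q)"
    proof (rule Lim_null_comparison[OF always_eventually e], rule allI)
      fix p :: "real \<times> real"
      have "\<bar>flux U (clamp_time (fst p)) (snd p) - flux U (clamp_time (fst q)) (snd p)\<bar> \<le>
          L2norm (\<lambda>m. U (clamp_time (fst p)) m - U (clamp_time (fst q)) m)"
        by (rule flux_diff_le) (rule U_L2[OF clamp_time(2)])+
      also have "\<dots> \<le> C * \<bar>clamp_time (fst p) - clamp_time (fst q)\<bar>"
        by (rule C(2)[OF clamp_time(1) clamp_time(1)])
      also have "\<dots> \<le> C * \<bar>fst p - fst q\<bar>"
        by (rule mult_left_mono[OF clamp_time(3) C(1)])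
      finally show "norm (?f p - ?f q) \<le> ?e p"
        using flux_holder[of U "clamp_time (fst q)" "snd p" "snd q", OF U_L2[OF clamp_time(2)]] by simp
    qed
    then show ?thesis by (simp add: LIM_zero_iff)
  qed
  then show ?thesis by (simp add: continuous_on_def)
qed

lemma clamped_flux_bounded:
  obtains B where "B \<ge> 0" "\<And>t m. \<bar>flux U (clamp_time t) m\<bar> \<le> B"
proof -
  obtain C where C: "C \<ge> 0"
    "\<And>s t. s \<in> {0..T} \<Longrightarrow> t \<in> {0..T} \<Longrightarrow> L2norm (\<lambda>m. U t m - U s m) \<le> C * \<bar>t - s\<bar>"
    using U_lipschitz by blast
  have "\<bar>flux U (clamp_time t) m\<bar> \<le> C * T + (LINT m|mu. \<bar>U 0 m\<bar>)" for t m
  proof -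
    have "\<bar>flux U (clamp_time t) m - flux U 0 m\<bar> \<le> L2norm (\<lambda>m. U (clamp_time t) m - U 0 m)"
      by (rule flux_diff_le) (rule U_L2, rule clamp_time(2), rule U_L2, simp)
    also have "\<dots> \<le> C * \<bar>clamp_time t - 0\<bar>" using T by (intro C(2) clamp_time(1)) auto
    also have "\<dots> \<le> C * T" using clamp_time(1)[of t] by (intro mult_left_mono C(1)) auto
    finally have 1: "\<bar>flux U (clamp_time t) m - flux U 0 m\<bar> \<le> C * T" .
    have U0: "L2 (U 0)" by (rule U_L2) simp
    have 2: "\<bar>flux U 0 m\<bar> \<le> (LINT m|mu. \<bar>U 0 m\<bar>)"
      unfolding flux_eq
    proof (rule abs_integral_le)
      show "integrable mu (\<lambda>w. indicator {..m} w * U 0 w)"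
        by (rule L2_integrable[OF L2_mult_bounded[OF U0 indicator_measurable_mu, where B = 1]])
          (simp add: indicator_def)
      show "integrable mu (\<lambda>m. \<bar>U 0 m\<bar>)" by (rule L2_integrable[OF L2_abs[OF U0]])
    qed (simp add: indicator_def)
    show ?thesis using 1 2 by linarith
  qed
  moreover have "0 \<le> C * T + (LINT m|mu. \<bar>U 0 m\<bar>)" using C(1) T by simp
  ultimately show ?thesis using that by blast
qed

end

section \<open>The entropy inequality\<close>

locale lagrangian_test =
  lagrangian F X0 V0 X U T + lipschitz_test_fun \<phi> \<phi>t \<phi>x R L
  for F :: "(real \<Rightarrow> real) \<Rightarrow> (real \<Rightarrow> real)" and X0 V0 :: "real \<Rightarrow> real"
    and X U :: "real \<Rightarrow> real \<Rightarrow> real" and T :: real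
    and \<phi> \<phi>t \<phi>x :: "real \<Rightarrow> real \<Rightarrow> real" and R L :: real +
  fixes k :: real
begin

text \<open>Equal, by \<open>G_eq\<close>, to the entropy integrated against
  \<open>\<phi> t\<close>. Writing the full space integral as the tail from \<open>- R\<close> lets
  the same Taylor estimates serve for the second summand.\<close>

definition G :: "real \<Rightarrow> real" where
  "G t = (LINT m|mu. sgn (m - k) * tail_int (\<phi> t) (X t m)) + \<bar>k\<bar> * tail_int (\<phi> t) (- R)"

text \<open>The derivative of \<open>G\<close> with the velocity replaced by \<open>U t\<close>; by
  \<open>J_eq\<close> it is the space integral of the entropy integrand.\<close>

definition J :: "real \<Rightarrow> real" where
  "J t = (LINT m|mu. sgn (m - k) * tail_int (\<phi>t t) (X t m))
    - (LINT m|mu. sgn (m - k) * \<phi> t (X t m) * U t m) + \<bar>k\<bar> * tail_int (\<phi>t t) (- R)"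

lemma X_measurable: "t \<ge> 0 \<Longrightarrow> X t \<in> borel_measurable mu"
  by (rule Kcone_measurable[OF X_Kcone])

lemma phi_measurable: "\<phi> t \<in> borel_measurable borel"
  by (rule borel_measurable_continuous_onI[OF cont_slices(1)])

lemma integrable_sgn_mult:
  assumes "f \<in> borel_measurable borel" "\<And>x. \<bar>f x\<bar> \<le> B" "t \<ge> 0"
  shows "integrable mu (\<lambda>m. sgn (m - k) * f (X t m))"
proof (rule integrable_mu_bounded[where B = B])
  show "(\<lambda>m. sgn (m - k) * f (X t m)) \<in> borel_measurable mu"
    by (intro borel_measurable_times sgn_shift_measurable_mu measurable_compose[OF X_measurable[OF assms(3)] assms(1)])
  show "\<bar>sgn (m - k) * f (X t m)\<bar> \<le> B" for m
    using assms(2)[of "X t m"] by (auto simp: abs_mult abs_sgn_eq)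
qed

lemma tail_bound: "\<bar>tail_int (\<phi> t) y\<bar> \<le> 2 * R * (2 * L * R)"
  by (rule tail_int_bound[OF integrable_slices(1) support(1) bound(1)])

lemma integrable_sgn_tail:
  assumes "t \<ge> 0"
  shows "integrable mu (\<lambda>m. sgn (m - k) * tail_int (\<phi> s) (X t m))"
    "integrable mu (\<lambda>m. sgn (m - k) * tail_int (\<phi>t s) (X t m))"
  by (rule integrable_sgn_mult[OF tail_measurable(1) tail_bound assms])
    (rule integrable_sgn_mult[OF tail_measurable(2) tail_bound_t assms])

lemma integrable_sgn_phi_mult:
  assumes "t \<ge> 0" "L2 W"
  shows "integrable mu (\<lambda>m. sgn (m - k) * \<phi> t (X t m) * W m)"
proof (rule L2_integrable[OF L2_mult_bounded[OF assms(2), where B = "2 * L * R"]])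
  show "(\<lambda>m. sgn (m - k) * \<phi> t (X t m)) \<in> borel_measurable mu"
    by (intro borel_measurable_times sgn_shift_measurable_mu measurable_compose[OF X_measurable[OF assms(1)] phi_measurable])
  show "\<bar>sgn (m - k) * \<phi> t (X t m)\<bar> \<le> 2 * L * R" for m
    using bound(1)[of t "X t m"] L_nonneg R_pos by (auto simp: abs_mult abs_sgn_eq)
qed

lemma G_lipschitz:
  obtains K where "K \<ge> 0" "\<And>s t. s \<in> {0..T} \<Longrightarrow> t \<in> {0..T} \<Longrightarrow> \<bar>G t - G s\<bar> \<le> K * \<bar>t - s\<bar>"
proof -
  obtain A where A: "A \<ge> 0"
    "\<And>s t. s \<in> {0..T} \<Longrightarrow> t \<in> {0..T} \<Longrightarrow> L2norm (\<lambda>m. X t m - X s m) \<le> A * \<bar>t - s\<bar>"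
    using X_lipschitz by blast
  define K where "K = 2 * R * L + 2 * L * R * A + \<bar>k\<bar> * (2 * R * L)"
  show ?thesis
  proof
    show "K \<ge> 0" using A(1) L_nonneg R_pos by (simp add: K_def)
    fix s t assume st: "s \<in> {0..T}" "t \<in> {0..T}"
    then have st0: "s \<ge> 0" "t \<ge> 0" by auto
    let ?g = "\<lambda>m. sgn (m - k) * tail_int (\<phi> t) (X t m) - sgn (m - k) * tail_int (\<phi> s) (X s m)"
    have D: "integrable mu (\<lambda>m. \<bar>X t m - X s m\<bar>)"
      by (rule L2_integrable[OF L2_abs[OF L2_diff[OF X_L2[OF st0(2)] X_L2[OF st0(1)]]]])
    have C: "integrable mu (\<lambda>m. 2 * R * (L * \<bar>t - s\<bar>))" by simp
    have D': "integrable mu (\<lambda>m. 2 * L * R * \<bar>X t m - X s m\<bar>)" by (rule integrable_mult_right[OF D])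
    have "\<bar>LINT m|mu. ?g m\<bar> \<le> (LINT m|mu. 2 * R * (L * \<bar>t - s\<bar>) + 2 * L * R * \<bar>X t m - X s m\<bar>)"
    proof (rule abs_integral_le)
      show "integrable mu ?g"
        by (intro Bochner_Integration.integrable_diff integrable_sgn_tail st0)
      show "integrable mu (\<lambda>m. 2 * R * (L * \<bar>t - s\<bar>) + 2 * L * R * \<bar>X t m - X s m\<bar>)"
        by (rule Bochner_Integration.integrable_add[OF C D'])
      fix m
      have "\<bar>?g m\<bar> \<le> \<bar>tail_int (\<phi> t) (X t m) - tail_int (\<phi> s) (X s m)\<bar>"
        by (simp add: right_diff_distrib[symmetric] abs_mult abs_sgn_eq)
      then show "\<bar>?g m\<bar> \<le> 2 * R * (L * \<bar>t - s\<bar>) + 2 * L * R * \<bar>X t m - X s m\<bar>"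
        using tail_lipschitz_time[of t "X t m" s] tail_lipschitz_space(1)[of s "X t m" "X s m"] by linarith
    qed
    moreover have "(LINT m|mu. 2 * R * (L * \<bar>t - s\<bar>) + 2 * L * R * \<bar>X t m - X s m\<bar>)
        = 2 * R * (L * \<bar>t - s\<bar>) + 2 * L * R * (LINT m|mu. \<bar>X t m - X s m\<bar>)"
      unfolding Bochner_Integration.integral_add[OF C D'] by simp
    moreover have "2 * L * R * (LINT m|mu. \<bar>X t m - X s m\<bar>) \<le> 2 * L * R * (A * \<bar>t - s\<bar>)"
      using order_trans[OF integral_abs_le_L2norm[OF L2_diff[OF X_L2[OF st0(2)] X_L2[OF st0(1)]]] A(2)[OF st]]
        L_nonneg R_pos by (intro mult_left_mono) auto
    moreover have "\<bar>\<bar>k\<bar> * (tail_int (\<phi> t) (-R) - tail_int (\<phi> s) (-R))\<bar> \<le> \<bar>k\<bar> * (2 * R * (L * \<bar>t - s\<bar>))"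
      unfolding abs_mult using tail_lipschitz_time[of t "-R" s] by (intro mult_mono) auto
    moreover have "G t - G s = (LINT m|mu. ?g m) + \<bar>k\<bar> * (tail_int (\<phi> t) (-R) - tail_int (\<phi> s) (-R))"
      unfolding G_def Bochner_Integration.integral_diff[OF integrable_sgn_tail(1)[OF st0(2)] integrable_sgn_tail(1)[OF st0(1)]]
      by (simp add: right_diff_distrib)
    ultimately have "\<bar>G t - G s\<bar> \<le> 2 * R * (L * \<bar>t - s\<bar>) + 2 * L * R * (A * \<bar>t - s\<bar>) + \<bar>k\<bar> * (2 * R * (L * \<bar>t - s\<bar>))"
      by linarith
    also have "\<dots> = K * \<bar>t - s\<bar>" by (simp add: K_def algebra_simps)
    finally show "\<bar>G t - G s\<bar> \<le> K * \<bar>t - s\<bar>" .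
  qed
qed

text \<open>With \<open>z = X (t + h) - X t\<close>, the tail is linear in \<open>z\<close> up to
  squares, and the Lipschitz bound on \<open>X\<close> makes the integral of the squares of order
  \<open>h\<close> squared. In the linear term \<open>z\<close> is traded for \<open>h * W\<close>
  at the cost \<open>h * v\<close>, where \<open>v\<close> is the error of the L2 difference
  quotient. After division by \<open>h\<close> every error tends to 0.\<close>

lemma G_deriv:
  assumes t: "0 < t" "t < T" and W: "has_L2_derivative X W t"
  shows "(G has_real_derivative
    (LINT m|mu. sgn (m - k) * tail_int (\<phi>t t) (X t m)) - (LINT m|mu. sgn (m - k) * \<phi> t (X t m) * W m)
      + \<bar>k\<bar> * tail_int (\<phi>t t) (- R)) (at t)"
    (is "(G has_real_derivative ?D) _")
proof -
  obtain A where A: "A \<ge> 0"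
    "\<And>s t. s \<in> {0..T} \<Longrightarrow> t \<in> {0..T} \<Longrightarrow> L2norm (\<lambda>m. X t m - X s m) \<le> A * \<bar>t - s\<bar>"
    using X_lipschitz by blast
  have L2W: "L2 W" using W by (simp add: has_L2_derivative_def)
  define C where "C = L * (2 + 2 * R)"
  have "C \<ge> 0" using L_nonneg R_pos by (simp add: C_def)
  define B where "B = 2 * L * R"
  have "B \<ge> 0" using L_nonneg R_pos by (simp add: B_def)
  define e where "e h = L2norm (\<lambda>m. (X (t + h) m - X t m) / h - W m)" for h
  have e_lim: "(e \<longlongrightarrow> 0) (at 0)" using W by (simp add: has_L2_derivative_def e_def[abs_def])
  have t0: "t \<ge> 0" using t by simp
  have tT: "t \<in> {0..T}" using t by simp
  have est: "\<bar>(G (t + h) - G t) / h - ?D\<bar> \<le> (C * (1 + A\<^sup>2) + \<bar>k\<bar> * (2 * R * L)) * \<bar>h\<bar> + B * e h"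
    if h: "h \<noteq> 0" "\<bar>h\<bar> < min t (T - t)" for h
  proof -
    \<comment> \<open>The restriction on \<open>h\<close> keeps both times where the Lipschitz bound
      on \<open>X\<close> holds.\<close>
    have th: "t + h \<in> {0..T}" using h by (auto simp: abs_if split: if_splits)
    then have th0: "t + h \<ge> 0" by simp
    define z where "z m = X (t + h) m - X t m" for m
    have L2z: "L2 z" unfolding z_def by (rule L2_diff[OF X_L2[OF th0] X_L2[OF t0]])
    define v where "v m = z m / h - W m" for m
    have L2v: "L2 v" unfolding v_def by (rule L2_diff[OF L2_divide[OF L2z] L2W])
    have ev: "L2norm v = e h" by (simp add: e_def v_def[abs_def] z_def)
    have nz: "(L2norm z)\<^sup>2 \<le> A\<^sup>2 * h\<^sup>2"
    proof -
      have "L2norm z \<le> A * \<bar>h\<bar>" using A(2)[OF tT th] by (simp add: z_def[abs_def])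
      then have "(L2norm z)\<^sup>2 \<le> (A * \<bar>h\<bar>)\<^sup>2" by (rule power_mono) simp
      then show ?thesis by (simp add: power_mult_distrib)
    qed
    note i1 = integrable_sgn_tail(1)[OF th0, of "t + h"] and i2 = integrable_sgn_tail(1)[OF t0, of t]
      and i3 = integrable_sgn_tail(2)[OF t0, of t] and i4 = integrable_sgn_phi_mult[OF t0 L2W]
    let ?r = "\<lambda>m. sgn (m - k) * tail_int (\<phi> (t + h)) (X (t + h) m) - sgn (m - k) * tail_int (\<phi> t) (X t m)
        - h * (sgn (m - k) * tail_int (\<phi>t t) (X t m) - sgn (m - k) * \<phi> t (X t m) * W m)"
    note i34 = Bochner_Integration.integrable_diff[OF i3 i4]
    have r_int: "integrable mu ?r" by (rule integral_diff_diff_mult(1)[OF i1 i2 i34])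
    have r_eq: "(LINT m|mu. ?r m) = (LINT m|mu. sgn (m - k) * tail_int (\<phi> (t + h)) (X (t + h) m))
        - (LINT m|mu. sgn (m - k) * tail_int (\<phi> t) (X t m))
        - h * ((LINT m|mu. sgn (m - k) * tail_int (\<phi>t t) (X t m)) - (LINT m|mu. sgn (m - k) * \<phi> t (X t m) * W m))"
      unfolding integral_diff_diff_mult(2)[OF i1 i2 i34] Bochner_Integration.integral_diff[OF i3 i4] ..
    have z_int: "integrable mu (\<lambda>m. (z m)\<^sup>2)" using L2z by (simp add: L2_iff)
    have c_int: "integrable mu (\<lambda>m. h\<^sup>2)" by simp
    have hz_int: "integrable mu (\<lambda>m. C * (h\<^sup>2 + (z m)\<^sup>2))"
      by (rule integrable_mult_right[OF Bochner_Integration.integrable_add[OF c_int z_int]])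
    have v_int: "integrable mu (\<lambda>m. B * \<bar>h\<bar> * \<bar>v m\<bar>)"
      by (rule integrable_mult_right[OF L2_integrable[OF L2_abs[OF L2v]]])
    have r_le: "\<bar>LINT m|mu. ?r m\<bar> \<le> (LINT m|mu. C * (h\<^sup>2 + (z m)\<^sup>2) + B * \<bar>h\<bar> * \<bar>v m\<bar>)"
    proof (rule abs_integral_le[OF r_int Bochner_Integration.integrable_add[OF hz_int v_int]])
      fix m
      define y where "y = X t m"
      have Xz: "X (t + h) m = y + z m" by (simp add: y_def z_def)
      have zhv: "z m - h * W m = h * v m" using h by (simp add: v_def field_simps)
      \<comment> \<open>The Taylor remainder with increment \<open>z m\<close>; what remains of the
        linear term is \<open>\<phi> t y * (h * v m)\<close>.\<close>
      define P where "P = tail_int (\<phi> (t + h)) (y + z m) - tail_int (\<phi> t) y - h * tail_int (\<phi>t t) y + z m * \<phi> t y"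
      have "?r m = sgn (m - k) * (P - \<phi> t y * (z m - h * W m))"
        unfolding Xz y_def[symmetric] P_def by (simp add: algebra_simps)
      then have r: "?r m = sgn (m - k) * (P - \<phi> t y * (h * v m))" unfolding zhv .
      have "\<bar>?r m\<bar> \<le> \<bar>P - \<phi> t y * (h * v m)\<bar>" unfolding r by (simp add: abs_mult abs_sgn_eq)
      moreover have "\<bar>P\<bar> \<le> C * (h\<^sup>2 + (z m)\<^sup>2)"
        unfolding P_def C_def by (rule tail_expansion)
      moreover have "\<bar>\<phi> t y * (h * v m)\<bar> \<le> B * \<bar>h\<bar> * \<bar>v m\<bar>"
        using mult_right_mono[OF bound(1)[of t y], of "\<bar>h * v m\<bar>"]
        by (simp add: abs_mult B_def mult.assoc)
      ultimately show "\<bar>?r m\<bar> \<le> C * (h\<^sup>2 + (z m)\<^sup>2) + B * \<bar>h\<bar> * \<bar>v m\<bar>" by linarith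
    qed
    have "(LINT m|mu. C * (h\<^sup>2 + (z m)\<^sup>2) + B * \<bar>h\<bar> * \<bar>v m\<bar>)
        = C * (h\<^sup>2 + (L2norm z)\<^sup>2) + B * \<bar>h\<bar> * (LINT m|mu. \<bar>v m\<bar>)"
      unfolding Bochner_Integration.integral_add[OF hz_int v_int] integral_mult_right_zero
        Bochner_Integration.integral_add[OF c_int z_int] L2norm_power2 by simp
    also have "\<dots> \<le> C * (h\<^sup>2 + A\<^sup>2 * h\<^sup>2) + B * \<bar>h\<bar> * e h"
      using integral_abs_le_L2norm[OF L2v] nz \<open>C \<ge> 0\<close> \<open>B \<ge> 0\<close> unfolding ev
      by (intro add_mono mult_left_mono) auto
    finally have r_le': "\<bar>LINT m|mu. ?r m\<bar> \<le> C * (h\<^sup>2 + A\<^sup>2 * h\<^sup>2) + B * \<bar>h\<bar> * e h" using r_le by linarith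
    define q where "q = tail_int (\<phi> (t + h)) (-R) - tail_int (\<phi> t) (-R) - h * tail_int (\<phi>t t) (-R)"
    have q_le: "\<bar>\<bar>k\<bar> * q\<bar> \<le> \<bar>k\<bar> * (2 * R * (L * h\<^sup>2))"
      unfolding abs_mult q_def using tail_diff_time[of t h "-R"] by (intro mult_mono) auto
    have "G (t + h) - G t - h * ?D = (LINT m|mu. ?r m) + \<bar>k\<bar> * q"
      unfolding r_eq G_def q_def by (simp add: algebra_simps)
    then have "\<bar>G (t + h) - G t - h * ?D\<bar> \<le> C * (h\<^sup>2 + A\<^sup>2 * h\<^sup>2) + B * \<bar>h\<bar> * e h + \<bar>k\<bar> * (2 * R * (L * h\<^sup>2))"
      using r_le' q_le by linarith
    also have "\<dots> = ((C * (1 + A\<^sup>2) + \<bar>k\<bar> * (2 * R * L)) * \<bar>h\<bar> + B * e h) * \<bar>h\<bar>"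
    proof -
      have "h\<^sup>2 = \<bar>h\<bar> * \<bar>h\<bar>" by (simp add: power2_eq_square)
      then show ?thesis by (simp only: algebra_simps)
    qed
    finally have le: "\<bar>G (t + h) - G t - h * ?D\<bar> \<le> ((C * (1 + A\<^sup>2) + \<bar>k\<bar> * (2 * R * L)) * \<bar>h\<bar> + B * e h) * \<bar>h\<bar>" .
    have "(G (t + h) - G t) / h - ?D = (G (t + h) - G t - h * ?D) / h"
      using h by (simp add: diff_divide_distrib)
    then have eq: "\<bar>(G (t + h) - G t) / h - ?D\<bar> = \<bar>G (t + h) - G t - h * ?D\<bar> / \<bar>h\<bar>"
      by (simp only: abs_divide)
    have "0 < \<bar>h\<bar>" using h by simp
    then show ?thesis unfolding eq by (simp only: pos_divide_le_eq le)
  qed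
  have "((\<lambda>h. (C * (1 + A\<^sup>2) + \<bar>k\<bar> * (2 * R * L)) * \<bar>h\<bar> + B * e h)
      \<longlongrightarrow> (C * (1 + A\<^sup>2) + \<bar>k\<bar> * (2 * R * L)) * \<bar>0\<bar> + B * 0) (at 0)"
    by (intro tendsto_intros e_lim)
  then have lim: "((\<lambda>h. (C * (1 + A\<^sup>2) + \<bar>k\<bar> * (2 * R * L)) * \<bar>h\<bar> + B * e h) \<longlongrightarrow> 0) (at 0)" by simp
  have "((\<lambda>h. (G (t + h) - G t) / h - ?D) \<longlongrightarrow> 0) (at 0)"
  proof (rule Lim_null_comparison[OF _ lim])
    show "\<forall>\<^sub>F h in at 0. norm ((G (t + h) - G t) / h - ?D)
        \<le> (C * (1 + A\<^sup>2) + \<bar>k\<bar> * (2 * R * L)) * \<bar>h\<bar> + B * e h"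
      unfolding eventually_at using est t
      by (intro exI[of _ "min t (T - t)"]) (simp add: dist_real_def)
  qed
  then show ?thesis by (simp add: DERIV_def LIM_zero_iff)
qed

text \<open>\<open>normal_cone_sgn\<close> applies because \<open>\<phi> t\<close> is nonnegative,
  bounded and Lipschitz. It shows that replacing \<open>W\<close> by \<open>U t\<close> in the
  derivative of \<open>G\<close> can only increase it.\<close>

lemma G_deriv_le_J:
  assumes t: "0 < t" "t < T" and W: "has_L2_derivative X W t"
    and cone: "(\<lambda>m. U t m - W m) \<in> normal_cone (X t)" and nonneg: "\<And>x. 0 \<le> \<phi> t x"
  shows "\<exists>D. (G has_real_derivative D) (at t) \<and> D \<le> J t"
proof -
  have t0: "t \<ge> 0" using t by simp
  have L2W: "L2 W" using W by (simp add: has_L2_derivative_def)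
  note i = integrable_sgn_phi_mult[OF t0 U_L2[OF t0]] integrable_sgn_phi_mult[OF t0 L2W]
  have "(LINT m|mu. sgn (m - k) * \<phi> t (X t m) * (U t m - W m)) \<le> 0"
  proof (rule normal_cone_sgn[OF X_Kcone[OF t0] cone nonneg _ _ L_nonneg phi_measurable])
    show "\<phi> t x \<le> 2 * L * R" for x using bound(1)[of t x] by linarith
    show "\<bar>\<phi> t x - \<phi> t y\<bar> \<le> L * \<bar>x - y\<bar>" for x y using lip[of t x t y] by simp
  qed
  moreover have "(LINT m|mu. sgn (m - k) * \<phi> t (X t m) * (U t m - W m))
      = (LINT m|mu. sgn (m - k) * \<phi> t (X t m) * U t m) - (LINT m|mu. sgn (m - k) * \<phi> t (X t m) * W m)"
    unfolding right_diff_distrib by (rule Bochner_Integration.integral_diff[OF i])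
  ultimately show ?thesis
    using G_deriv[OF t W] unfolding J_def by (intro exI conjI) (assumption, linarith)
qed

text \<open>The tail of \<open>\<phi>x t\<close> is \<open>- \<phi> t\<close>, which produces the
  transport term. Since \<open>\<phi>x t\<close> has zero space integral, the constant
  \<open>flux U t k\<close> disappears, while \<open>\<bar>k\<bar>\<close> survives together with
  \<open>\<phi>t\<close>.\<close>

lemma J_eq:
  assumes t: "t \<ge> 0"
  shows "(LINT x|lborel. \<bar>gen_inv (X t) x - k\<bar> * \<phi>t t x
      + sgn (gen_inv (X t) x - k) * (flux U t (gen_inv (X t) x) - flux U t k) * \<phi>x t x) = J t"
proof -
  note a = abs_entropy_integral[OF X_Kcone[OF t] integrable_slices(2), of k t]
  note f = flux_entropy_integral[of "X t" U t, OF X_Kcone[OF t] U_L2[OF t] integrable_slices(3), of k t]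
  have "(LINT m|mu. sgn (m - k) * U t m * - \<phi> t (X t m)) = - (LINT m|mu. sgn (m - k) * \<phi> t (X t m) * U t m)"
    by (simp add: mult_ac)
  then show ?thesis
    unfolding Bochner_Integration.integral_add[OF a(2) f(2)] a(1) f(1) J_def tail_phi_x integral_phi_x
      tail_eq_integral(2)[OF order_refl]
    by simp
qed

lemma G_eq:
  assumes "t \<ge> 0"
  shows "G t = (LINT x|lborel. \<bar>gen_inv (X t) x - k\<bar> * \<phi> t x)"
  unfolding abs_entropy_integral(1)[OF X_Kcone[OF assms] integrable_slices(1)] G_def
    tail_eq_integral(1)[OF order_refl] ..

text \<open>The entropy integrand with clamped time: Borel on the whole plane and equal to the
  original on the strip.\<close>

definition H :: "real \<times> real \<Rightarrow> real" where
  "H p = \<bar>gen_inv (X (clamp_time (fst p))) (snd p) - k\<bar> * \<phi>t (fst p) (snd p)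
    + sgn (gen_inv (X (clamp_time (fst p))) (snd p) - k)
      * (flux U (clamp_time (fst p)) (gen_inv (X (clamp_time (fst p))) (snd p)) - flux U (clamp_time (fst p)) k)
      * \<phi>x (fst p) (snd p)"

lemma H_measurable: "H \<in> borel_measurable borel"
proof -
  note [measurable] = clamped_gen_inv_measurable borel_measurable_continuous_onI[OF cont_t]
    borel_measurable_continuous_onI[OF cont_x] borel_measurable_continuous_onI[OF clamped_flux_continuous]
  have fst: "fst \<in> borel_measurable (borel :: (real \<times> real) measure)"
    by (intro borel_measurable_continuous_onI continuous_intros)
  have "(\<lambda>p. (fst p, gen_inv (X (clamp_time (fst p))) (snd p))) \<in> borel_measurable (borel :: (real \<times> real) measure)"
    by (rule borel_measurable_Pair[OF fst clamped_gen_inv_measurable])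
  from measurable_compose[OF this borel_measurable_continuous_onI[OF clamped_flux_continuous]]
  have [measurable]: "(\<lambda>p. flux U (clamp_time (fst p)) (gen_inv (X (clamp_time (fst p))) (snd p)))
      \<in> borel_measurable (borel :: (real \<times> real) measure)"
    by simp
  have "(\<lambda>p. (fst p, k)) \<in> borel_measurable (borel :: (real \<times> real) measure)"
    by (rule borel_measurable_Pair[OF fst]) simp
  from measurable_compose[OF this borel_measurable_continuous_onI[OF clamped_flux_continuous]]
  have [measurable]: "(\<lambda>p. flux U (clamp_time (fst p)) k) \<in> borel_measurable (borel :: (real \<times> real) measure)"
    by simp
  show ?thesis unfolding H_def[abs_def] by measurable
qed

lemma H_integrable: "integrable lborel (\<lambda>p. indicator ({0<..<T} \<times> UNIV) p * H p)"
proof -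
  let ?K = "{0..T} \<times> {-R..R}"
  have "compact ((\<lambda>p. \<phi>x (fst p) (snd p)) ` ?K)"
    by (intro compact_continuous_image continuous_on_subset[OF cont_x] compact_Times) auto
  then obtain P where P: "\<And>p. p \<in> ?K \<Longrightarrow> \<bar>\<phi>x (fst p) (snd p)\<bar> \<le> P"
    by (meson bounded_real compact_imp_bounded imageI)
  obtain B where B: "B \<ge> 0" "\<And>t m. \<bar>flux U (clamp_time t) m\<bar> \<le> B"
    using clamped_flux_bounded by blast
  \<comment> \<open>\<open>\<bar>M - k\<bar> \<le> 1 + \<bar>k\<bar>\<close>, as \<open>M\<close>
    lies in \<open>[0, 1]\<close>, meets the bound on \<open>\<phi>t\<close>; two flux values, each
    at most \<open>B\<close>, meet the bound \<open>P\<close> on \<open>\<phi>x\<close>.\<close>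
  define Q where "Q = (1 + \<bar>k\<bar>) * (2 * L * R) + 2 * B * P"
  have H_le: "\<bar>H p\<bar> \<le> Q" if p: "p \<in> ?K" for p
  proof -
    define M where "M = gen_inv (X (clamp_time (fst p))) (snd p)"
    have M: "0 \<le> M" "M \<le> 1"
      unfolding M_def by (rule gen_inv_nonneg) (rule gen_inv_le_1[OF X_measurable[OF clamp_time(2)]])
    have "\<bar>\<bar>M - k\<bar> * \<phi>t (fst p) (snd p)\<bar> \<le> (1 + \<bar>k\<bar>) * (2 * L * R)"
      unfolding abs_mult using M by (intro mult_mono bound) auto
    moreover have "\<bar>sgn (M - k) * (flux U (clamp_time (fst p)) M - flux U (clamp_time (fst p)) k)\<bar> \<le> 1 * (2 * B)"
      unfolding abs_mult using B(2)[of "fst p" M] B(2)[of "fst p" k]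
      by (intro mult_mono) (auto simp: abs_sgn_eq)
    then have "\<bar>sgn (M - k) * (flux U (clamp_time (fst p)) M - flux U (clamp_time (fst p)) k) * \<phi>x (fst p) (snd p)\<bar> \<le> 2 * B * P"
      unfolding abs_mult[of "_ * _" "\<phi>x _ _"] using B(1) by (intro mult_mono P[OF p]) auto
    ultimately show ?thesis unfolding H_def M_def[symmetric] Q_def by linarith
  qed
  have "integrable lborel (\<lambda>p. indicator ?K p * Q)"
  proof -
    have "?K = cbox (0, -R) (T, R)" by (simp add: cbox_Pair_eq)
    moreover have "integrable lborel (indicator (cbox (0, -R) (T, R)) :: real \<times> real \<Rightarrow> real)"
      by (rule integrable_real_indicator) (simp_all only: lborelD_Collect sets_lborel borel_closed closed_cbox emeasure_lborel_cbox_finite)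
    ultimately show ?thesis by (simp add: integrable_mult_left)
  qed
  then show ?thesis
  proof (rule Bochner_Integration.integrable_bound)
    note [measurable] = H_measurable
    show "(\<lambda>p. indicator ({0<..<T} \<times> UNIV) p * H p) \<in> borel_measurable lborel"
    proof -
      have "{0<..<T} \<times> (UNIV :: real set) \<in> sets borel" by (intro borel_open open_Times) auto
      then show ?thesis by simp
    qed
    show "AE p in lborel. norm (indicator ({0<..<T} \<times> UNIV) p * H p) \<le> norm (indicator ?K p * Q)"
    proof (rule AE_I2)
      fix p :: "real \<times> real"
      show "norm (indicator ({0<..<T} \<times> UNIV) p * H p) \<le> norm (indicator ?K p * Q)"
      proof (cases "fst p \<in> {0<..<T} \<and> \<bar>snd p\<bar> < R")
        case True
        then have "p \<in> ?K" by (auto simp: mem_Times_iff abs_less_iff)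
        then have "\<bar>H p\<bar> \<le> Q" by (rule H_le)
        moreover from this have "0 \<le> Q" by linarith
        ultimately show ?thesis using \<open>p \<in> ?K\<close> by (simp add: indicator_def)
      next
        case False
        then have eq: "indicator ({0<..<T} \<times> UNIV) p * H p = 0"
          using support(2,3)[of "snd p" "fst p"] by (auto simp: H_def indicator_def mem_Times_iff)
        show ?thesis unfolding eq by simp
      qed
    qed
  qed
qed

lemma entropy_inequality:
  assumes nonneg: "\<And>t x. 0 \<le> t \<Longrightarrow> t < T \<Longrightarrow> 0 \<le> \<phi> t x" and final: "\<And>x. \<phi> T x = 0"
  shows "0 \<le> (LINT p:({0<..<T} \<times> UNIV)|lebesgue.
        \<bar>gen_inv (X (fst p)) (snd p) - k\<bar> * \<phi>t (fst p) (snd p)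
        + sgn (gen_inv (X (fst p)) (snd p) - k) * (flux U (fst p) (gen_inv (X (fst p)) (snd p)) - flux U (fst p) k)
          * \<phi>x (fst p) (snd p))
    + (LINT x|lebesgue. \<bar>gen_inv X0 x - k\<bar> * \<phi> 0 x)"
proof -
  let ?S = "{0<..<T} \<times> (UNIV :: real set)"
  let ?H = "\<lambda>p. \<bar>gen_inv (X (fst p)) (snd p) - k\<bar> * \<phi>t (fst p) (snd p)
        + sgn (gen_inv (X (fst p)) (snd p) - k) * (flux U (fst p) (gen_inv (X (fst p)) (snd p)) - flux U (fst p) k)
          * \<phi>x (fst p) (snd p)"
  have H_eq: "?H p = H p" if "fst p \<in> {0..T}" for p
    by (simp only: H_def clamp_time(4)[OF that])
  have int: "integrable (lborel \<Otimes>\<^sub>M lborel) (\<lambda>p. indicator ?S p * H p)"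
    using H_integrable by (simp only: lborel_prod)
  have slice: "(LINT x|lborel. indicator ?S (t, x) * H (t, x)) = indicator {0<..<T} t * J t" for t
  proof (cases "t \<in> {0<..<T}")
    case True
    then have "?H (t, x) = H (t, x)" for x by (intro H_eq) simp
    then have "indicator ?S (t, x) * H (t, x) = ?H (t, x)" for x using True by (simp only:) simp
    then have "(LINT x|lborel. indicator ?S (t, x) * H (t, x)) = (LINT x|lborel. ?H (t, x))"
      by (simp only:)
    also have "\<dots> = J t" using J_eq[of t] True by simp
    finally show ?thesis using True by simp
  next
    case False
    then show ?thesis by simp
  qed
  have "(LINT p:?S|lebesgue. ?H p) = (LINT p|lebesgue. indicator ?S p * H p)"
    unfolding set_lebesgue_integral_def
  proof (rule Bochner_Integration.integral_cong)
    fix p :: "real \<times> real"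
    show "indicator ?S p *\<^sub>R ?H p = indicator ?S p * H p"
    proof (cases "p \<in> ?S")
      case True
      then have "fst p \<in> {0..T}" by (auto simp: mem_Times_iff)
      from H_eq[OF this] show ?thesis by (simp only: real_scaleR_def)
    qed simp
  qed simp
  also have "\<dots> = (LINT p|lborel. indicator ?S p * H p)"
    by (rule integral_completion) (use H_integrable in simp)
  also have "\<dots> = (LINT t|lborel. LINT x|lborel. indicator ?S (t, x) * H (t, x))"
    using lborel_pair.integral_fst'[OF int] by (simp only: lborel_prod)
  also have "\<dots> = (LINT t:{0<..<T}|lborel. J t)"
    unfolding slice set_lebesgue_integral_def by simp
  finally have J_integral: "(LINT p:?S|lebesgue. ?H p) = (LINT t:{0<..<T}|lborel. J t)" .
  \<comment> \<open>Slicing the integrable \<open>H\<close> also yields measurability of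
    \<open>J\<close> in time, which its definition does not show.\<close>
  have J_int: "set_integrable lborel {0<..<T} J"
    using lborel_pair.integrable_fst'[OF int] unfolding slice set_integrable_def by simp
  obtain K where K: "K \<ge> 0" "\<And>s t. s \<in> {0..T} \<Longrightarrow> t \<in> {0..T} \<Longrightarrow> \<bar>G t - G s\<bar> \<le> K * \<bar>t - s\<bar>"
    using G_lipschitz by blast
  have "G T - G 0 \<le> (LINT t:{0<..<T}|lborel. J t)"
  proof (rule lipschitz_increment_le_integral[OF T K _ J_int])
    have "AE t in lborel. t > 0 \<longrightarrow> (\<exists>W. has_L2_derivative X W t \<and> (\<lambda>m. U t m - W m) \<in> normal_cone (X t))"
      using sol by (simp add: lagrangian_solution_def)
    then show "AE t in lborel. t \<in> {0<..<T} \<longrightarrow> (\<exists>D. (G has_real_derivative D) (at t) \<and> D \<le> J t)"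
    proof eventually_elim
      case (elim t)
      show ?case
      proof
        assume t: "t \<in> {0<..<T}"
        then obtain W where "has_L2_derivative X W t" "(\<lambda>m. U t m - W m) \<in> normal_cone (X t)"
          using elim by auto
        then show "\<exists>D. (G has_real_derivative D) (at t) \<and> D \<le> J t"
          using t nonneg by (intro G_deriv_le_J) auto
      qed
    qed
  qed
  moreover have "G T = 0" using T by (simp add: G_eq final)
  moreover have "G 0 = (LINT x|lebesgue. \<bar>gen_inv X0 x - k\<bar> * \<phi> 0 x)"
  proof -
    have X0m: "X0 \<in> borel_measurable mu" by (rule Kcone_measurable[OF X0])
    have "AE m in mu. X 0 m = X0 m"
      using sol by (simp add: lagrangian_solution_def AE_mu_iff)
    \<comment> \<open>The initial condition holds only almost everywhere, but this fixes the inverse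
      at every \<open>x\<close>.\<close>
    then have eq: "gen_inv (X 0) x = gen_inv X0 x" for x
      by (intro gen_inv_cong_AE X_measurable X0m) simp
    have "(LINT x|lebesgue. \<bar>gen_inv X0 x - k\<bar> * \<phi> 0 x) = (LINT x|lborel. \<bar>gen_inv X0 x - k\<bar> * \<phi> 0 x)"
      using gen_inv_borel[OF X0m] phi_measurable by (intro integral_completion) simp
    then show ?thesis by (simp add: G_eq eq)
  qed
  ultimately show ?thesis unfolding J_integral by linarith
qed

end

section \<open>Verification of the conditions on an entropy solution\<close>

theorem theorem5p5:
  fixes F :: "(real \<Rightarrow> real) \<Rightarrow> (real \<Rightarrow> real)"
    and X0 V0 :: "real \<Rightarrow> real"
    and X U :: "real \<Rightarrow> real \<Rightarrow> real"
    and T :: real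
  assumes "unif_cont_K F"
    and "X0 \<in> Kcone"
    and "L2 V0"
    and "T > 0"
    and "lagrangian_solution F X0 V0 X U"
  shows "entropy_solution T (\<lambda>t x. gen_inv (X t) x) (flux U) (gen_inv X0)"
  unfolding entropy_solution_def
proof (intro conjI)
  interpret lagrangian F X0 V0 X U T
    using assms by unfold_locales
  have Xm: "X t \<in> borel_measurable mu" if "t \<ge> 0" for t
    by (rule Kcone_measurable[OF X_Kcone[OF that]])
  have open_strip: "{0<..<T} \<times> (UNIV :: real set) \<in> sets borel" by (intro borel_open open_Times) auto
  show "(\<lambda>p. indicator ({0<..<T} \<times> UNIV) p * gen_inv (X (fst p)) (snd p)) \<in> borel_measurable lebesgue"
  proof -
    have "(\<lambda>p. indicator ({0<..<T} \<times> UNIV) p * gen_inv (X (clamp_time (fst p))) (snd p))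
        \<in> borel_measurable lborel"
      using open_strip clamped_gen_inv_measurable by simp
    moreover have "indicator ({0<..<T} \<times> UNIV) p * gen_inv (X (clamp_time (fst p))) (snd p)
        = indicator ({0<..<T} \<times> UNIV) p * gen_inv (X (fst p)) (snd p)" for p :: "real \<times> real"
      using clamp_time(4)[of "fst p"] by (auto simp: indicator_def)
    ultimately show ?thesis by (simp add: measurable_completion)
  qed
  show "\<exists>B. AE p in lebesgue. p \<in> {0<..<T} \<times> UNIV \<longrightarrow> \<bar>gen_inv (X (fst p)) (snd p)\<bar> \<le> B"
    by (intro exI[of _ 1] AE_I2) (use gen_inv_nonneg gen_inv_le_1[OF Xm] in \<open>auto simp: less_imp_le\<close>)
  have int: "integrable lborel (\<lambda>x. indicator {a..b} x * gen_inv (X t) x)" if "t \<ge> 0" for a b t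
  proof (rule Bochner_Integration.integrable_bound[OF integrable_indicator_Icc[of a b]])
    show "(\<lambda>x. indicator {a..b} x * gen_inv (X t) x) \<in> borel_measurable lborel"
      using gen_inv_borel[OF Xm[OF that]] by simp
    show "AE x in lborel. norm (indicator {a..b} x * gen_inv (X t) x) \<le> norm (indicator {a..b} x :: real)"
      using gen_inv_nonneg gen_inv_le_1[OF Xm[OF that]] by (auto simp: indicator_def)
  qed
  show "\<forall>t\<in>{0..T}. \<forall>a b. set_integrable lebesgue {a..b} (gen_inv (X t))"
  proof (intro ballI allI)
    fix t a b assume "t \<in> {0..T}"
    then have "t \<ge> 0" by simp
    from int[OF this] show "set_integrable lebesgue {a..b} (gen_inv (X t))"
      unfolding set_integrable_def by (simp add: integrable_completion)
  qed
  show "\<forall>t\<in>{0..T}. \<forall>a b.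
      ((\<lambda>s. LINT x:{a..b}|lebesgue. \<bar>gen_inv (X s) x - gen_inv (X t) x\<bar>) \<longlongrightarrow> 0) (at t within {0..T})"
  proof (intro ballI allI)
    fix t a b assume t: "t \<in> {0..T}"
    then have t0: "t \<ge> 0" by simp
    obtain A where A: "A \<ge> 0"
      "\<And>s t. s \<in> {0..T} \<Longrightarrow> t \<in> {0..T} \<Longrightarrow> L2norm (\<lambda>m. X t m - X s m) \<le> A * \<bar>t - s\<bar>"
      using X_lipschitz by blast
    \<comment> \<open>The L1 contraction, then L1 below L2 on unit mass, then the Lipschitz bound on
      \<open>X\<close>; the bound is independent of \<open>a\<close> and \<open>b\<close>.\<close>
    have le: "norm (LINT x:{a..b}|lebesgue. \<bar>gen_inv (X s) x - gen_inv (X t) x\<bar>) \<le> A * \<bar>s - t\<bar>"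
      if s: "s \<in> {0..T}" for s
    proof -
      have s0: "s \<ge> 0" using s by simp
      have "(LINT x:{a..b}|lebesgue. \<bar>gen_inv (X s) x - gen_inv (X t) x\<bar>)
          = (LINT x|lborel. indicator {a..b} x * \<bar>gen_inv (X s) x - gen_inv (X t) x\<bar>)"
        unfolding set_lebesgue_integral_def real_scaleR_def
        using gen_inv_borel[OF Xm[OF s0]] gen_inv_borel[OF Xm[OF t0]] by (intro integral_completion) simp
      also have "\<dots> \<le> (LINT m|mu. \<bar>X s m - X t m\<bar>)"
        by (rule gen_inv_L1_contraction[OF X_L2[OF s0] X_L2[OF t0]])
      also have "\<dots> \<le> L2norm (\<lambda>m. X s m - X t m)"
        by (rule integral_abs_le_L2norm[OF L2_diff[OF X_L2[OF s0] X_L2[OF t0]]])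
      also have "\<dots> \<le> A * \<bar>s - t\<bar>" by (rule A(2)[OF t s])
      finally have "(LINT x:{a..b}|lebesgue. \<bar>gen_inv (X s) x - gen_inv (X t) x\<bar>) \<le> A * \<bar>s - t\<bar>" .
      moreover have "0 \<le> (LINT x:{a..b}|lebesgue. \<bar>gen_inv (X s) x - gen_inv (X t) x\<bar>)"
        unfolding set_lebesgue_integral_def by (intro Bochner_Integration.integral_nonneg) simp
      ultimately show ?thesis by simp
    qed
    have "((\<lambda>s. A * \<bar>s - t\<bar>) \<longlongrightarrow> A * \<bar>t - t\<bar>) (at t within {0..T})" by (intro tendsto_intros)
    then have lim: "((\<lambda>s. A * \<bar>s - t\<bar>) \<longlongrightarrow> 0) (at t within {0..T})" by simp
    show "((\<lambda>s. LINT x:{a..b}|lebesgue. \<bar>gen_inv (X s) x - gen_inv (X t) x\<bar>) \<longlongrightarrow> 0) (at t within {0..T})"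
      by (rule Lim_null_comparison[OF _ lim]) (use le in \<open>auto simp: eventually_at_filter\<close>)
  qed
  show "\<exists>D. closure D = UNIV \<and> (\<forall>k\<in>D. \<forall>\<phi>. test_fun T \<phi> \<longrightarrow>
      0 \<le> (LINT p:({0<..<T} \<times> UNIV)|lebesgue.
          \<bar>gen_inv (X (fst p)) (snd p) - k\<bar> * dt \<phi> p
          + sgn (gen_inv (X (fst p)) (snd p) - k) * (flux U (fst p) (gen_inv (X (fst p)) (snd p)) - flux U (fst p) k) * dx \<phi> p)
        + (LINT x|lebesgue. \<bar>gen_inv X0 x - k\<bar> * \<phi> (0, x)))"
  \<comment> \<open>The inequality holds for every real \<open>k\<close>, so the dense set is the
    whole line.\<close>
  proof (intro exI[of _ UNIV] conjI ballI allI impI)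
    fix k :: real and \<phi> :: "real \<times> real \<Rightarrow> real"
    assume \<phi>: "test_fun T \<phi>"
    obtain R L where "lipschitz_test_fun (\<lambda>t x. \<phi> (t, x)) (\<lambda>t x. dt \<phi> (t, x)) (\<lambda>t x. dx \<phi> (t, x)) R L"
      using test_fun_lipschitz_test_fun[OF \<phi>] .
    then interpret lagrangian_test F X0 V0 X U T "\<lambda>t x. \<phi> (t, x)" "\<lambda>t x. dt \<phi> (t, x)" "\<lambda>t x. dx \<phi> (t, x)" R L k
      using lagrangian_axioms by (intro lagrangian_test.intro)
    have "0 \<le> \<phi> (t, x)" if "0 \<le> t" "t < T" for t x
      using \<phi> that by (simp add: test_fun_def)
    \<comment> \<open>The compact set carrying the test function lies strictly before the time
      \<open>T\<close>.\<close>
    moreover have "\<phi> (T, x) = 0" for x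
      using \<phi> unfolding test_fun_def by fastforce
    ultimately show "0 \<le> (LINT p:({0<..<T} \<times> UNIV)|lebesgue.
          \<bar>gen_inv (X (fst p)) (snd p) - k\<bar> * dt \<phi> p
          + sgn (gen_inv (X (fst p)) (snd p) - k) * (flux U (fst p) (gen_inv (X (fst p)) (snd p)) - flux U (fst p) k) * dx \<phi> p)
        + (LINT x|lebesgue. \<bar>gen_inv X0 x - k\<bar> * \<phi> (0, x))"
      using entropy_inequality by simp
  qed simp
qed

end
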